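(* Let $p$ be a polynomial with real coefficients in $n$ variables that is homogeneous of degree $d$ and hyperbolic with respect to $e\in\mathbb{R}^n$, and suppose its hyperbolicity cone $\Lambda_+(p,e)$ is pointed. Then $-\log p$ (with domain $\mathrm{int}(\Lambda_+(p,e))$) is a pairwise-self-concordant barrier for $\Lambda_+(p,e)$.
   Context: Hyperbolic polynomials. A homogeneous real polynomial $p$ of degree $d$ in $n$ variables is hyperbolic with respect to $e\in\mathbb{R}^n$ if $p(e)>0$ and, for every fixed $x\in\mathbb{R}^n$, every root $t$ of $p(te-x)=0$ is real. The $d$ roots (with multiplicity) are denoted $\lambda_1^{(p,e)}(x)\ge\cdots\ge\lambda_d^{(p,e)}(x)$. The hyperbolicity cone is $\Lambda_+(p,e)=\{x\in\mathbb{R}^n:\lambda_i^{(p,e)}(x)\ge0,\ i=1,\dots,d\}$, a closed convex cone. A convex cone $K\subseteq\mathbb{R}^n$ is pointed if $K\cap(-K)=\{0\}$ and full-dimensional if $\mathrm{span}(K)=\mathbb{R}^n$. Barriers. $D^kf(x)[u_1,\dots,u_k]=\frac{\partial^k}{\partial t_1\cdots\partial t_k}f(x+t_1u_1+\cdots+t_ku_k)|_{t_1=\cdots=t_k=0}$. A three-times continuously differentiable closed convex function $\phi:\mathrm{dom}(\phi)\to\mathbb{R}$ with open domain $\mathrm{dom}(\phi)\subseteq\mathbb{R}^n$ is standard self-concordant if $|D^3\phi(x)[u,u,u]|\le 2D^2\phi(x)[u,u]^{3/2}$ for all $x\in\mathrm{dom}(\phi)$, $u\in\mathbb{R}^n$.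 It is a $\nu$-logarithmically homogeneous self-concordant barrier for a closed full-dimensional convex cone $K$ if in addition $\mathrm{cl}(\mathrm{dom}(\phi))=K$ and $\phi(tx)=\phi(x)-\nu\log t$ for all $x\in\mathrm{dom}(\phi)$, $t>0$. Write $x\preceq_K y$ if $y-x\in K$, and for $x\in\mathrm{int}(K)$ put $|u|_x=\inf\{t\in\mathbb{R}: -tx\preceq_K u\preceq_K tx\}$. For a closed, pointed, full-dimensional convex cone $K$, a logarithmically homogeneous self-concordant barrier $\phi$ for $K$ is pairwise-self-concordant if for all $u,v\in K$ and all $x\in\mathrm{int}(K)$, $0\le -D^3\phi(x)[v,u,u]\le 2D^2\phi(x)[v,u]\,|u|_x$. *)

theory Defs
  imports
    "HOL-Analysis.Analysis"
    "HOL-Computational_Algebra.Polynomial"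
    "HOL-Library.Poly_Mapping"
begin

section \<open>Hyperbolic polynomials\<close>

text \<open>A polynomial in the variables \<open>'n\<close> maps finitely many exponent vectors to their
  nonzero coefficients.\<close>

type_synonym 'n rmpoly = "('n \<Rightarrow>\<^sub>0 nat) \<Rightarrow>\<^sub>0 real"

text \<open>Substitution of elements \<open>f i\<close> of a commutative ring for the variables, where \<open>h\<close> embeds the
  real coefficients into that ring.\<close>

definition mp_subst :: "(real \<Rightarrow> 'b) \<Rightarrow> ('n::finite) rmpoly \<Rightarrow> ('n \<Rightarrow> 'b::comm_ring_1) \<Rightarrow> 'b" where
  "mp_subst h p f = (\<Sum>m\<in>Poly_Mapping.keys p. h (Poly_Mapping.lookup p m) *
      (\<Prod>i\<in>UNIV. f i ^ Poly_Mapping.lookup m i))"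

definition mp_eval :: "('n::finite) rmpoly \<Rightarrow> real ^ 'n \<Rightarrow> real" where
  "mp_eval p x = mp_subst (\<lambda>c. c) p (\<lambda>i. x $ i)"

definition homogeneous :: "nat \<Rightarrow> ('n::finite) rmpoly \<Rightarrow> bool" where
  "homogeneous d p \<longleftrightarrow> (\<forall>m\<in>Poly_Mapping.keys p. (\<Sum>i\<in>UNIV. Poly_Mapping.lookup m i) = d)"

text \<open>All complex solutions \<open>t\<close> of \<open>p (t e - x) = 0\<close> are real.\<close>

definition hyperbolic :: "('n::finite) rmpoly \<Rightarrow> real ^ 'n \<Rightarrow> bool" where
  "hyperbolic p e \<longleftrightarrow>
     mp_eval p e > 0 \<and>
     (\<forall>x. \<forall>t::complex.
        mp_subst complex_of_real p (\<lambda>i. t * complex_of_real (e $ i) - complex_of_real (x $ i)) = 0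
        \<longrightarrow> t \<in> \<real>)"

text \<open>The univariate polynomial \<open>p (t e - x)\<close> in \<open>t\<close>.\<close>

definition line_poly :: "('n::finite) rmpoly \<Rightarrow> real ^ 'n \<Rightarrow> real ^ 'n \<Rightarrow> real poly" where
  "line_poly p e x = mp_subst (\<lambda>c. [:c:]) p (\<lambda>i. [:- (x $ i), e $ i:])"

text \<open>The \<open>i\<close>-th largest root, counted with multiplicity and starting from \<open>i = 1\<close>; only meaningful
  for \<open>i \<le> d\<close> when \<open>p\<close> is homogeneous of degree \<open>d\<close> and hyperbolic, since there are exactly \<open>d\<close>
  real roots then.\<close>

definition hyp_eigenvalue :: "('n::finite) rmpoly \<Rightarrow> real ^ 'n \<Rightarrow> nat \<Rightarrow> real ^ 'n \<Rightarrow> real" where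
  "hyp_eigenvalue p e i x = rev (sorted_list_of_multiset (proots (line_poly p e x))) ! (i - 1)"

definition hyp_cone :: "nat \<Rightarrow> ('n::finite) rmpoly \<Rightarrow> real ^ 'n \<Rightarrow> (real ^ 'n) set" where
  "hyp_cone d p e = {x. \<forall>i\<in>{1..d}. hyp_eigenvalue p e i x \<ge> 0}"


section \<open>Cones and barriers\<close>

definition pointed_cone :: "'a::real_vector set \<Rightarrow> bool" where
  "pointed_cone K \<longleftrightarrow> K \<inter> uminus ` K = {0}"

definition full_dimensional :: "'a::real_vector set \<Rightarrow> bool" where
  "full_dimensional K \<longleftrightarrow> span K = UNIV"

text \<open>The iterated partial derivative at \<open>t\<^sub>1 = \<dots> = t\<^sub>k = 0\<close> of
  \<open>f (x + t\<^sub>1 u\<^sub>1 + \<dots> + t\<^sub>k u\<^sub>k)\<close>, the derivative with respect to \<open>t\<^sub>1\<close> being outermost.\<close>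

fun Dk :: "('a::real_normed_vector \<Rightarrow> real) \<Rightarrow> 'a \<Rightarrow> 'a list \<Rightarrow> real" where
  "Dk f x [] = f x"
| "Dk f x (u # us) = deriv (\<lambda>t. Dk f (x + t *\<^sub>R u) us) 0"

text \<open>\<open>f\<close> is \<open>k\<close> times continuously differentiable on the open set \<open>S\<close>. Directional derivatives are
  used in the recursion so that its type stays fixed; in finite dimension this is no restriction.\<close>

fun cont_diff_on :: "nat \<Rightarrow> ('a::euclidean_space \<Rightarrow> real) \<Rightarrow> 'a set \<Rightarrow> bool" where
  "cont_diff_on 0 f S \<longleftrightarrow> continuous_on S f"
| "cont_diff_on (Suc k) f S \<longleftrightarrow>
     (\<forall>x\<in>S. f differentiable (at x)) \<and>
     (\<forall>v. cont_diff_on k (\<lambda>x. frechet_derivative f (at x) v) S)"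

text \<open>The domain \<open>D\<close> of \<open>\<phi>\<close> is explicit; values of \<open>\<phi>\<close> outside \<open>D\<close> play no role. A convex function
  is closed if its epigraph is a closed set.\<close>

definition standard_self_concordant :: "'a::euclidean_space set \<Rightarrow> ('a \<Rightarrow> real) \<Rightarrow> bool" where
  "standard_self_concordant D \<phi> \<longleftrightarrow>
     open D \<and> cont_diff_on 3 \<phi> D \<and> convex_on D \<phi> \<and> closed (epigraph D \<phi>) \<and>
     (\<forall>x\<in>D. \<forall>u. \<bar>Dk \<phi> x [u, u, u]\<bar> \<le> 2 * Dk \<phi> x [u, u] powr (3 / 2))"

definition log_homogeneous_barrier ::
    "real \<Rightarrow> 'a::euclidean_space set \<Rightarrow> 'a set \<Rightarrow> ('a \<Rightarrow> real) \<Rightarrow> bool" where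
  "log_homogeneous_barrier \<nu> K D \<phi> \<longleftrightarrow>
     closed K \<and> convex_cone K \<and> full_dimensional K \<and>
     standard_self_concordant D \<phi> \<and> closure D = K \<and>
     (\<forall>x\<in>D. \<forall>t>0. t *\<^sub>R x \<in> D \<and> \<phi> (t *\<^sub>R x) = \<phi> x - \<nu> * ln t)"

definition cone_le :: "'a::real_vector set \<Rightarrow> 'a \<Rightarrow> 'a \<Rightarrow> bool" where
  "cone_le K x y \<longleftrightarrow> y - x \<in> K"

definition cone_norm :: "'a::real_vector set \<Rightarrow> 'a \<Rightarrow> 'a \<Rightarrow> real" where
  "cone_norm K x u = Inf {t. cone_le K (- t *\<^sub>R x) u \<and> cone_le K u (t *\<^sub>R x)}"

definition pairwise_self_concordant ::
    "'a::euclidean_space set \<Rightarrow> 'a set \<Rightarrow> ('a \<Rightarrow> real) \<Rightarrow> bool" where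
  "pairwise_self_concordant K D \<phi> \<longleftrightarrow>
     pointed_cone K \<and> (\<exists>\<nu>. log_homogeneous_barrier \<nu> K D \<phi>) \<and>
     (\<forall>u\<in>K. \<forall>v\<in>K. \<forall>x\<in>interior K.
        0 \<le> - Dk \<phi> x [v, u, u] \<and>
        - Dk \<phi> x [v, u, u] \<le> 2 * Dk \<phi> x [v, u] * cone_norm K x u)"

end

theory Submission
  imports Defs "HOL-Computational_Algebra.Fundamental_Theorem_Algebra"
begin

text \<open>The nonvanishing component of \<open>e\<close> is the open cone \<open>C\<close> of points all of whose eigenvalues are
  positive.  A homotopy of complex roots shows that \<open>C\<close> is closed under addition and that
  \<open>p (x + \<i> a) \<noteq> 0\<close> for real \<open>x\<close> and \<open>a \<in> C\<close>, i.e. \<open>p\<close> is hyperbolic in every direction of \<open>C\<close>;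
  the closure of \<open>C\<close> is the hyperbolicity cone.

  Fix \<open>x \<in> C\<close>.  Since \<open>p (x + t u) = p x \<cdot> (\<Prod>j. 1 + t \<lambda>\<^sub>j)\<close> with real \<open>\<lambda>\<^sub>j\<close>, the
  derivatives of the barrier along \<open>u\<close> are power sums of the \<open>\<lambda>\<^sub>j\<close>, which gives self-concordance.
  For \<open>u, v\<close> in the cone, \<open>p (t x - u + s v)\<close> has no zero with \<open>Im t > 0\<close> and \<open>Im s \<ge> 0\<close>, hence
  the logarithmic derivative of \<open>p\<close> along \<open>v\<close> at \<open>t x - u\<close> maps the upper half-plane in \<open>t\<close> to the
  closed lower one.  It is therefore \<open>\<Sum>r. m\<^sub>r / (t - r)\<close> with \<open>m\<^sub>r \<ge> 0\<close>, and \<open>0 \<le> r \<le> |u|\<^sub>x\<close> for every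
  pole.  So \<open>D\<^sup>2\<phi>[v,u] = \<Sum>r. m\<^sub>r r\<close> and \<open>- D\<^sup>3\<phi>[v,u,u] = 2 (\<Sum>r. m\<^sub>r r\<^sup>2)\<close>, from which both pairwise
  inequalities are immediate.\<close>

section \<open>Substitution into polynomials\<close>

text \<open>A ring homomorphism passes through the sum, products and powers of a substitution. The
  later instances embed the reals into the complex numbers or evaluate univariate and bivariate
  polynomials, which is how each substituted polynomial is identified by its values.\<close>

lemma mp_subst_hom:
  fixes p :: "('n::finite) rmpoly" and \<psi> :: "'b::comm_ring_1 \<Rightarrow> 'c::comm_ring_1"
  assumes "\<psi> 0 = 0" "\<psi> 1 = 1" "\<And>a b. \<psi> (a + b) = \<psi> a + \<psi> b" "\<And>a b. \<psi> (a * b) = \<psi> a * \<psi> b"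
  shows "\<psi> (mp_subst h p f) = mp_subst (\<lambda>c. \<psi> (h c)) p (\<lambda>i. \<psi> (f i))"
proof -
  have pow: "\<psi> (a ^ k) = \<psi> a ^ k" for a k
    by (induction k) (auto simp: assms)
  have pr: "\<psi> (prod F A) = (\<Prod>i\<in>A. \<psi> (F i))" if "finite A" for F and A :: "'n set"
    using that by (induction A) (auto simp: assms)
  have sm: "\<psi> (sum F A) = (\<Sum>i\<in>A. \<psi> (F i))" if "finite A" for F and A :: "('n \<Rightarrow>\<^sub>0 nat) set"
    using that by (induction A) (auto simp: assms)
  show ?thesis
    by (simp add: mp_subst_def sm pr pow assms)
qed

lemma mp_subst_cong: "(\<And>i. f i = g i) \<Longrightarrow> mp_subst h p f = mp_subst h p g"
  by (simp add: mp_subst_def)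

lemma mp_subst_homogeneous:
  assumes "homogeneous d p"
  shows "mp_subst h p (\<lambda>i. c * f i) = c ^ d * mp_subst h p f"
proof -
  have "(\<Prod>i\<in>UNIV. (c * f i) ^ Poly_Mapping.lookup m i) =
      c ^ d * (\<Prod>i\<in>UNIV. f i ^ Poly_Mapping.lookup m i)" if "m \<in> Poly_Mapping.keys p" for m
    using assms that
    by (simp add: homogeneous_def power_mult_distrib prod.distrib power_sum [symmetric])
  then show ?thesis
    by (simp add: mp_subst_def sum_distrib_left mult_ac)
qed

lemma mp_eval_scaleR:
  "homogeneous d p \<Longrightarrow> mp_eval p (c *\<^sub>R x) = c ^ d * mp_eval p x"
  using mp_subst_homogeneous [of d p "\<lambda>c. c" c "\<lambda>i. x $ i"] by (simp add: mp_eval_def)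

definition mp_ceval :: "('n::finite) rmpoly \<Rightarrow> complex ^ 'n \<Rightarrow> complex" where
  "mp_ceval p z = mp_subst complex_of_real p (\<lambda>i. z $ i)"

lemma mp_ceval_smult:
  "homogeneous d p \<Longrightarrow> mp_ceval p (c *s z) = c ^ d * mp_ceval p z"
  using mp_subst_homogeneous [of d p complex_of_real c "\<lambda>i. z $ i"] by (simp add: mp_ceval_def)

definition cvec :: "real ^ 'n \<Rightarrow> complex ^ 'n" where
  "cvec x = (\<chi> i. complex_of_real (x $ i))"

lemma cvec_nth [simp]: "cvec x $ i = complex_of_real (x $ i)"
  by (simp add: cvec_def)

lemma cvec_simps:
  "cvec (x + y) = cvec x + cvec y" "cvec (x - y) = cvec x - cvec y" "cvec (- x) = - cvec x"
  "cvec (r *\<^sub>R x) = complex_of_real r *s cvec x" "cvec 0 = 0"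
  by (simp_all add: vec_eq_iff)

lemma mp_ceval_cvec: "mp_ceval p (cvec x) = complex_of_real (mp_eval p x)"
  unfolding mp_ceval_def mp_eval_def
  by (subst mp_subst_hom [where \<psi> = complex_of_real]) (auto intro: mp_subst_cong)

lemma continuous_on_mp_ceval [continuous_intros]:
  "continuous_on S f \<Longrightarrow> continuous_on S (\<lambda>x. mp_ceval p (f x))"
  unfolding mp_ceval_def mp_subst_def by (intro continuous_intros)

lemma continuous_on_mp_eval [continuous_intros]:
  "continuous_on S f \<Longrightarrow> continuous_on S (\<lambda>x. mp_eval p (f x))"
  unfolding mp_eval_def mp_subst_def by (intro continuous_intros)

text \<open>This is the definition applied to \<open>- x\<close>, so that sums rather than
  differences appear in the homotopy arguments.\<close>

lemma hyperbolic_ceval: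
  assumes "hyperbolic p e" "mp_ceval p (t *s cvec e + cvec x) = 0"
  shows "t \<in> \<real>"
proof -
  have "mp_subst complex_of_real p
      (\<lambda>i. t * complex_of_real (e $ i) - complex_of_real ((- x) $ i)) = 0"
    using assms(2) unfolding mp_ceval_def by (simp add: mp_subst_def)
  then show ?thesis using assms(1) unfolding hyperbolic_def by blast
qed

lemma continuous_on_smult_vec [continuous_intros]:
  fixes f :: "'a::topological_space \<Rightarrow> complex" and g :: "'a \<Rightarrow> complex ^ 'n"
  assumes "continuous_on S f" "continuous_on S g"
  shows "continuous_on S (\<lambda>x. f x *s g x)"
  unfolding vector_scalar_mult_def using assms by (intro continuous_intros)

section \<open>Degree bounds and top coefficients, where the bound need not be the exact
  degree\<close>

lemma degree_le_coeff_mult: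
  fixes q r :: "'a::comm_ring_1 poly"
  assumes "degree q \<le> n" "degree r \<le> m"
  shows "degree (q * r) \<le> n + m \<and> coeff (q * r) (n + m) = coeff q n * coeff r m"
proof -
  have d: "degree (q * r) \<le> n + m"
    using degree_mult_le [of q r] assms by linarith
  have "coeff (q * r) (n + m) = (\<Sum>i\<le>n + m. coeff q i * coeff r (n + m - i))"
    by (simp add: coeff_mult)
  also have "\<dots> = (\<Sum>i\<in>{n}. coeff q i * coeff r (n + m - i))"
  proof (rule sum.mono_neutral_right)
    show "\<forall>i\<in>{..n + m} - {n}. coeff q i * coeff r (n + m - i) = 0"
    proof
      fix i assume "i \<in> {..n + m} - {n}"
      then have "i > n \<or> n + m - i > m" by auto
      then show "coeff q i * coeff r (n + m - i) = 0"
        using assms by (auto simp: coeff_eq_0)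
    qed
  qed auto
  finally show ?thesis using d by simp
qed

lemma degree_le_coeff_power:
  fixes q :: "'a::comm_ring_1 poly"
  assumes "degree q \<le> n"
  shows "degree (q ^ k) \<le> n * k \<and> coeff (q ^ k) (n * k) = coeff q n ^ k"
proof (induction k)
  case (Suc k)
  then show ?case
    using degree_le_coeff_mult [OF assms, of "q ^ k" "n * k"] by simp
qed auto

lemma degree_le_coeff_prod:
  fixes q :: "'i \<Rightarrow> 'a::comm_ring_1 poly"
  assumes "finite A" "\<And>i. i \<in> A \<Longrightarrow> degree (q i) \<le> n i"
  shows "degree (prod q A) \<le> sum n A \<and> coeff (prod q A) (sum n A) = (\<Prod>i\<in>A. coeff (q i) (n i))"
  using assms
proof (induction A)
  case (insert i A)
  then show ?case
    using degree_le_coeff_mult [of "q i" "n i" "prod q A" "sum n A"] by simp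
qed auto

text \<open>By homogeneity every monomial becomes a product of exactly \<open>d\<close> linear
  factors, and the coefficient at \<open>d\<close> collects their slopes. The slopes may be zero,
  hence a bound on the degree instead of an equality.\<close>

lemma mp_subst_linear_degree:
  fixes h :: "real \<Rightarrow> 'a::comm_ring_1"
  assumes hom: "homogeneous d p"
  shows "degree (mp_subst (\<lambda>c. [:h c:]) p (\<lambda>i. [:a i, b i:])) \<le> d"
    and "coeff (mp_subst (\<lambda>c. [:h c:]) p (\<lambda>i. [:a i, b i:])) d = mp_subst h p b"
proof -
  define M where "M m = (\<Prod>i\<in>UNIV. [:a i, b i:] ^ Poly_Mapping.lookup m i)" for m
  have M: "degree (M m) \<le> d" "coeff (M m) d = (\<Prod>i\<in>UNIV. b i ^ Poly_Mapping.lookup m i)"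
    if "m \<in> Poly_Mapping.keys p" for m
  proof -
    have 1: "degree [:a i, b i:] \<le> 1" for i by simp
    note 2 = degree_le_coeff_power [OF 1]
    have "(\<Sum>i\<in>UNIV. Poly_Mapping.lookup m i) = d"
      using hom that by (simp add: homogeneous_def)
    then show "degree (M m) \<le> d" "coeff (M m) d = (\<Prod>i\<in>UNIV. b i ^ Poly_Mapping.lookup m i)"
      using degree_le_coeff_prod [of UNIV "\<lambda>i. [:a i, b i:] ^ Poly_Mapping.lookup m i"
          "\<lambda>i. Poly_Mapping.lookup m i"] 2
      by (simp_all add: M_def)
  qed
  show "degree (mp_subst (\<lambda>c. [:h c:]) p (\<lambda>i. [:a i, b i:])) \<le> d"
    unfolding mp_subst_def M_def [symmetric]
    by (rule degree_sum_le) (auto intro: order.trans [OF degree_smult_le] M)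
  show "coeff (mp_subst (\<lambda>c. [:h c:]) p (\<lambda>i. [:a i, b i:])) d = mp_subst h p b"
    unfolding mp_subst_def M_def [symmetric] coeff_sum
    by (rule sum.cong) (auto simp: M)
qed

text \<open>Total degree in two variables, for a polynomial in one variable over the polynomials in
  the other. The zero polynomial has \<open>degree\<close> 0, so without the first disjunct every
  index \<open>k > n\<close> would violate the bound.\<close>

definition total_degree_le :: "nat \<Rightarrow> 'a::comm_ring_1 poly poly \<Rightarrow> bool" where
  "total_degree_le n B \<longleftrightarrow> (\<forall>k. coeff B k = 0 \<or> degree (coeff B k) + k \<le> n)"

lemma total_degree_le_mult:
  assumes "total_degree_le n A" "total_degree_le m B"
  shows "total_degree_le (n + m) (A * B)"
  unfolding total_degree_le_def
proof
  fix k
  show "coeff (A * B) k = 0 \<or> degree (coeff (A * B) k) + k \<le> n + m"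
  proof (rule disjCI)
    assume nz: "\<not> degree (coeff (A * B) k) + k \<le> n + m"
    have z: "coeff A i * coeff B (k - i) = 0 \<or> degree (coeff A i * coeff B (k - i)) + k \<le> n + m"
      if "i \<le> k" for i
    proof -
      have "coeff A i = 0 \<or> degree (coeff A i) + i \<le> n"
         "coeff B (k-i) = 0 \<or> degree (coeff B (k-i)) + (k-i) \<le> m"
        using assms by (auto simp: total_degree_le_def)
      then show ?thesis
        using degree_mult_le [of "coeff A i" "coeff B (k - i)"] that by auto
    qed
    show "coeff (A * B) k = 0"
    proof (cases "k \<le> n + m")
      case True
      have "degree (coeff (A * B) k) \<le> n + m - k"
        unfolding coeff_mult
      proof (rule degree_sum_le)
        fix i assume "i \<in> {..k}"
        then show "degree (coeff A i * coeff B (k - i)) \<le> n + m - k"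
          using z [of i] by auto
      qed auto
      then show ?thesis using nz True by linarith
    next
      case False
      then have "coeff A i * coeff B (k - i) = 0" if "i \<le> k" for i
        using z [OF that] by linarith
      then show ?thesis by (simp add: coeff_mult)
    qed
  qed
qed

lemma total_degree_le_1: "total_degree_le 0 1"
  by (simp add: total_degree_le_def)

lemma total_degree_le_power:
  "total_degree_le n A \<Longrightarrow> total_degree_le (n * k) (A ^ k)"
  by (induction k) (auto simp: total_degree_le_1 intro: total_degree_le_mult)

lemma total_degree_le_prod:
  assumes "finite I" "\<And>i. i \<in> I \<Longrightarrow> total_degree_le (n i) (A i)"
  shows "total_degree_le (sum n I) (prod A I)"
  using assms by (induction I) (auto simp: total_degree_le_1 intro: total_degree_le_mult)

lemma total_degree_le_add:
  assumes "total_degree_le n A" "total_degree_le n B"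
  shows "total_degree_le n (A + B)"
  unfolding total_degree_le_def
proof
  fix k
  have "coeff A k = 0 \<or> degree (coeff A k) + k \<le> n" "coeff B k = 0 \<or> degree (coeff B k) + k \<le> n"
    using assms by (auto simp: total_degree_le_def)
  then show "coeff (A + B) k = 0 \<or> degree (coeff (A + B) k) + k \<le> n"
    using degree_add_le_max [of "coeff A k" "coeff B k"] by (auto simp: max_def split: if_splits)
qed

lemma total_degree_le_sum:
  assumes "finite I" "\<And>i. i \<in> I \<Longrightarrow> total_degree_le n (A i)"
  shows "total_degree_le n (sum A I)"
  using assms
proof (induction I)
  case empty then show ?case by (simp add: total_degree_le_def)
qed (auto intro: total_degree_le_add)

text \<open>The polynomial \<open>p (t x - u + s v)\<close>, in \<open>s\<close> over the polynomials in \<open>t\<close>.\<close>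

definition line_poly2 :: "('n::finite) rmpoly \<Rightarrow> real ^ 'n \<Rightarrow> real ^ 'n \<Rightarrow> real ^ 'n \<Rightarrow> real poly poly"
  where "line_poly2 p x u v = mp_subst (\<lambda>c. [:[:c:]:]) p (\<lambda>i. [:[:- (u $ i), x $ i:], [:v $ i:]:])"

text \<open>Each substituted form has total degree at most 1 and each monomial multiplies
  \<open>d\<close> of them. The consequence used later is that the coefficient of \<open>s\<close>
  is zero or has degree below \<open>d\<close> in \<open>t\<close>.\<close>

lemma total_degree_line_poly2:
  assumes "homogeneous d p"
  shows "total_degree_le d (line_poly2 p x u v)"
  unfolding line_poly2_def mp_subst_def
proof (rule total_degree_le_sum)
  fix m assume m: "m \<in> Poly_Mapping.keys p"
  have "total_degree_le (1 * Poly_Mapping.lookup m i)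
      ([:[:- (u $ i), x $ i:], [:v $ i:]:] ^ Poly_Mapping.lookup m i)" for i
  proof (rule total_degree_le_power, unfold total_degree_le_def, intro allI)
    fix k
    show "coeff [:[:- (u $ i), x $ i:], [:v $ i:]:] k = 0 \<or>
        degree (coeff [:[:- (u $ i), x $ i:], [:v $ i:]:] k) + k \<le> 1"
      by (cases k rule: old.nat.exhaust; cases "k - 1") auto
  qed
  then have "total_degree_le (\<Sum>i\<in>UNIV. Poly_Mapping.lookup m i)
     (\<Prod>i\<in>UNIV. [:[:- (u $ i), x $ i:], [:v $ i:]:] ^ Poly_Mapping.lookup m i)"
    by (intro total_degree_le_prod) auto
  moreover have "total_degree_le 0 [:[:Poly_Mapping.lookup p m:]:]"
    unfolding total_degree_le_def
    by (metis add_0_right coeff_pCons_0 coeff_0 degree_pCons_0 le_refl not0_implies_Suc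
        coeff_pCons_Suc)
  ultimately show "total_degree_le d ([:[:Poly_Mapping.lookup p m:]:] *
     (\<Prod>i\<in>UNIV. [:[:- (u $ i), x $ i:], [:v $ i:]:] ^ Poly_Mapping.lookup m i))"
    using m assms total_degree_le_mult by (fastforce simp: homogeneous_def)
qed simp

lemma poly_line_poly2: "poly (poly (line_poly2 p x u v) [:s:]) t = mp_eval p (t *\<^sub>R x - u + s *\<^sub>R v)"
  unfolding line_poly2_def mp_eval_def
  by (subst mp_subst_hom [where \<psi> = "\<lambda>B. poly (poly B [:s:]) t"]) (auto simp: algebra_simps intro: mp_subst_cong)

section \<open>Complexification of the line polynomials\<close>

abbreviation cpoly :: "real poly \<Rightarrow> complex poly" where
  "cpoly \<equiv> map_poly complex_of_real"

lemma cpoly_add: "cpoly (q + r) = cpoly q + cpoly r"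
  by (rule poly_eqI) (simp add: coeff_map_poly)

lemma cpoly_mult: "cpoly (q * r) = cpoly q * cpoly r"
  by (rule poly_eqI) (simp add: coeff_map_poly coeff_mult)

lemma poly_cpoly_of_real: "poly (cpoly q) (complex_of_real x) = complex_of_real (poly q x)"
  by (induction q) (auto simp: map_poly_pCons)

lemma degree_cpoly [simp]: "degree (cpoly q) = degree q"
  by (rule degree_map_poly) auto

text \<open>The inner variable \<open>t\<close> is frozen at a complex number \<open>z\<close>; what
  remains is a complex polynomial in \<open>s\<close> to which root arguments apply.\<close>

definition line_poly2_at :: "('n::finite) rmpoly \<Rightarrow> real ^ 'n \<Rightarrow> real ^ 'n \<Rightarrow> real ^ 'n \<Rightarrow> complex \<Rightarrow> complex poly"
  where "line_poly2_at p x u v z = map_poly (\<lambda>b. poly (cpoly b) z) (line_poly2 p x u v)"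

lemma coeff_line_poly2_at:
  "coeff (line_poly2_at p x u v z) k = poly (cpoly (coeff (line_poly2 p x u v) k)) z"
  by (simp add: line_poly2_at_def coeff_map_poly)

lemma poly_line_poly2_at:
  "poly (line_poly2_at p x u v z) s = mp_ceval p (z *s cvec x - cvec u + s *s cvec v)"
proof -
  define \<psi> where "\<psi> B = poly (map_poly (\<lambda>b. poly (cpoly b) z) B) s" for B
  have 1: "map_poly (\<lambda>b. poly (cpoly b) z) (A + B) =
     map_poly (\<lambda>b. poly (cpoly b) z) A + map_poly (\<lambda>b. poly (cpoly b) z) B" for A B
    by (rule poly_eqI) (simp add: coeff_map_poly cpoly_add)
  have cs: "cpoly (sum F A) = (\<Sum>i\<in>A. cpoly (F i))" for F and A :: "nat set"
    by (induction A rule: infinite_finite_induct) (auto simp: cpoly_add)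
  have 2: "map_poly (\<lambda>b. poly (cpoly b) z) (A * B) =
     map_poly (\<lambda>b. poly (cpoly b) z) A * map_poly (\<lambda>b. poly (cpoly b) z) B" for A B
    by (rule poly_eqI) (simp add: coeff_map_poly cpoly_mult coeff_mult cs poly_sum)
  have "\<psi> (line_poly2 p x u v) = mp_ceval p (z *s cvec x - cvec u + s *s cvec v)"
    unfolding line_poly2_def mp_ceval_def
    by (subst mp_subst_hom [where \<psi> = \<psi>]) (auto simp: \<psi>_def 1 2 map_poly_pCons algebra_simps
        map_poly_1' intro: mp_subst_cong)
  then show ?thesis by (simp add: \<psi>_def line_poly2_at_def)
qed

lemma poly_line_poly: "poly (line_poly p e x) t = mp_eval p (t *\<^sub>R e - x)"
  unfolding line_poly_def mp_eval_def
  by (subst mp_subst_hom [where \<psi> = "\<lambda>B. poly B t"]) (auto simp: algebra_simps intro: mp_subst_cong)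

lemma poly_cpoly_line_poly: "poly (cpoly (line_poly p e x)) t = mp_ceval p (t *s cvec e - cvec x)"
  unfolding line_poly_def mp_ceval_def
  by (subst mp_subst_hom [where \<psi> = "\<lambda>B. poly (cpoly B) t"])
    (auto simp: algebra_simps cpoly_add cpoly_mult map_poly_pCons map_poly_1' intro: mp_subst_cong)

lemma coeff_0_line_poly2: "coeff (line_poly2 p x u v) 0 = line_poly p x u"
proof -
  have "poly (coeff (line_poly2 p x u v) 0) t = poly (line_poly p x u) t" for t
    using poly_line_poly2 [of p x u v 0 t] by (simp add: poly_line_poly poly_0_coeff_0)
  then show ?thesis by (simp add: poly_eq_poly_eq_iff [symmetric] fun_eq_iff)
qed

lemma degree_line_poly:
  assumes "homogeneous d p"
  shows "degree (line_poly p x u) \<le> d" "coeff (line_poly p x u) d = mp_eval p x"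
  using mp_subst_linear_degree [OF assms, of "\<lambda>c. c" "\<lambda>i. - (u $ i)" "\<lambda>i. x $ i"]
  by (auto simp: line_poly_def mp_eval_def)

section \<open>Rational functions preserving half-planes\<close>

text \<open>The ratio is the logarithmic derivative at 0, that is, minus the sum of
  \<open>1 / r\<close> over the roots \<open>r\<close>. All roots lie in the open lower half-plane,
  so each \<open>1 / r\<close> has nonnegative imaginary part. The induction splits off one root at
  a time.\<close>

lemma Im_coeff_ratio_nonpos:
  fixes q :: "complex poly"
  assumes "\<And>s. Im s \<ge> 0 \<Longrightarrow> poly q s \<noteq> 0"
  shows "Im (coeff q 1 / coeff q 0) \<le> 0"
  using assms
proof (induction "degree q" arbitrary: q)
  case 0
  then show ?case by (simp add: coeff_eq_0)
next
  case (Suc n)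
  then have "\<not> constant (poly q)" by (simp add: constant_degree)
  then obtain r where r: "poly q r = 0" using fundamental_theorem_of_algebra by blast
  then obtain q' where q': "q = [:- r, 1:] * q'" by (auto simp: poly_eq_0_iff_dvd)
  have "Im r < 0" using Suc.prems [of r] r by linarith
  have nz: "poly q' s \<noteq> 0" if "Im s \<ge> 0" for s using Suc.prems [OF that] q' by auto
  have "q' \<noteq> 0" using nz [of 0] by auto
  then have "degree q = Suc (degree q')" by (simp add: q' degree_mult_eq del: mult_pCons_left)
  then have IH: "Im (coeff q' 1 / coeff q' 0) \<le> 0" using Suc.hyps nz by simp
  have c0: "coeff q' 0 \<noteq> 0" using nz [of 0] by (simp add: poly_0_coeff_0)
  have "r \<noteq> 0" using \<open>Im r < 0\<close> by auto
  have "coeff q 1 / coeff q 0 = coeff q' 1 / coeff q' 0 - inverse r"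
    using c0 \<open>r \<noteq> 0\<close> by (simp add: q' divide_simps)
  moreover have "Im (inverse r) \<ge> 0"
    using \<open>Im r < 0\<close> by (simp add: divide_nonpos_nonneg)
  ultimately show ?case using IH by simp
qed

text \<open>Induction on the degree: a complex root exists, is real by hypothesis, and therefore
  splits off a linear factor over the reals.\<close>

lemma real_rooted_factorization:
  fixes q :: "real poly"
  assumes "\<And>z. poly (cpoly q) z = 0 \<Longrightarrow> z \<in> \<real>"
  obtains l :: "nat \<Rightarrow> real" where "q = smult (lead_coeff q) (\<Prod>j<degree q. [:- l j, 1:])"
proof -
  have "\<exists>l :: nat \<Rightarrow> real. q = smult (lead_coeff q) (\<Prod>j<degree q. [:- l j, 1:])"
    using assms
  proof (induction "degree q" arbitrary: q)
    case 0
    then have "q = [:lead_coeff q:]" using degree_0_id [of q] by simp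
    with 0 show ?case by simp
  next
    case (Suc n)
    then have "\<not> constant (poly (cpoly q))" by (simp add: constant_degree)
    then obtain z where z: "poly (cpoly q) z = 0" using fundamental_theorem_of_algebra by blast
    then obtain r where r: "z = complex_of_real r" using Suc.prems by (auto elim: Reals_cases)
    then have "poly q r = 0" using z by (simp add: poly_cpoly_of_real)
    then obtain q' where q': "q = [:- r, 1:] * q'" by (auto simp: poly_eq_0_iff_dvd)
    have "q' \<noteq> 0" using Suc.hyps(2) q' by auto
    then have d: "degree q = Suc (degree q')" by (simp add: q' degree_mult_eq del: mult_pCons_left)
    have "\<And>z. poly (cpoly q') z = 0 \<Longrightarrow> z \<in> \<real>"
      using Suc.prems by (simp add: q' cpoly_mult del: mult_pCons_left)
    then obtain l :: "nat \<Rightarrow> real"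
      where l: "q' = smult (lead_coeff q') (\<Prod>j<degree q'. [:- l j, 1:])"
      using Suc.hyps(1) [of q'] Suc.hyps(2) d by auto
    have "lead_coeff q = lead_coeff q'"
      by (simp add: q' lead_coeff_mult del: mult_pCons_left)
    have "q = [:- r, 1:] * smult (lead_coeff q') (\<Prod>j<degree q'. [:- l j, 1:])"
      using q' l by simp
    also have "\<dots> = smult (lead_coeff q) ([:- r, 1:] * (\<Prod>j<degree q'. [:- l j, 1:]))"
      by (simp only: \<open>lead_coeff q = lead_coeff q'\<close> mult_smult_right)
    also have "[:- r, 1:] * (\<Prod>j<degree q'. [:- l j, 1:]) =
        (\<Prod>j<degree q. [:- (l(degree q' := r)) j, 1:])"
      unfolding d prod.lessThan_Suc by (simp add: mult.commute del: mult_pCons_left mult_pCons_right)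
    finally show ?case by blast
  qed
  then show ?thesis using that by blast
qed

text \<open>For a real polynomial \<open>proots\<close> sees only real roots; the hypothesis says
  that none are missed.\<close>

lemma size_proots_real_rooted:
  fixes q :: "real poly"
  assumes "q \<noteq> 0" "\<And>z. poly (cpoly q) z = 0 \<Longrightarrow> z \<in> \<real>"
  shows "size (proots q) = degree q"
proof -
  obtain l :: "nat \<Rightarrow> real" where "q = smult (lead_coeff q) (\<Prod>j<degree q. [:- l j, 1:])"
    using real_rooted_factorization assms(2) by blast
  then have "proots q = proots (smult (lead_coeff q) (\<Prod>j<degree q. [:- l j, 1:]))" by simp
  also have "\<dots> = (\<Sum>j<degree q. {#l j#})" using assms(1) by (simp add: proots_prod)
  finally show ?thesis by simp
qed

text \<open>Near a pole of order \<open>n\<close> the quotient is asymptotic to \<open>c / (z - r) ^ n\<close>; on a small upper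
  half-circle around \<open>r\<close> its argument sweeps an angle \<open>n \<pi>\<close>, which leaves the lower half-plane unless
  \<open>n = 1\<close>.\<close>

lemma nevanlinna_pole_simple:
  fixes f1 g :: "real poly"
  assumes im: "\<And>z. Im z > 0 \<Longrightarrow> Im (poly (cpoly g) z / poly (cpoly ([:- r, 1:] ^ n * f1)) z) \<le> 0"
    and n: "n > 0" and g: "poly g r \<noteq> 0" and f1: "poly f1 r \<noteq> 0"
  shows "n = 1" "poly g r / poly f1 r \<ge> 0"
proof -
  define c where "c = poly g r / poly f1 r"
  \<comment> \<open>Approach \<open>r\<close> along \<open>r + \<epsilon> w\<close> and multiply by
    the positive number \<open>\<epsilon> ^ n\<close>: the sign of the imaginary part is kept, and
    the limit is the leading term \<open>c / w ^ n\<close>.\<close>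
  have key: "Im (complex_of_real c / w ^ n) \<le> 0" if w: "Im w > 0" for w
  proof -
    define z where "z \<epsilon> = complex_of_real r + complex_of_real \<epsilon> * w" for \<epsilon> :: real
    define H where "H \<epsilon> = poly (cpoly g) (z \<epsilon>) / poly (cpoly f1) (z \<epsilon>) / w ^ n" for \<epsilon> :: real
    have "w \<noteq> 0" using w by auto
    have "continuous (at 0) H"
      unfolding H_def z_def using f1 \<open>w \<noteq> 0\<close>
      by (intro continuous_intros) (auto simp: poly_cpoly_of_real)
    then have "(H \<longlongrightarrow> H 0) (at_right 0)"
      by (simp add: continuous_at_imp_continuous_at_within continuous_within [symmetric])
    then have lim: "((\<lambda>\<epsilon>. Im (H \<epsilon>)) \<longlongrightarrow> Im (H 0)) (at_right 0)" by (rule tendsto_Im)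
    have "Im (H \<epsilon>) \<le> 0" if "\<epsilon> > 0" for \<epsilon>
    proof -
      have pw: "poly (cpoly ([:- r, 1:] ^ k)) (z \<epsilon>) = (\<epsilon> * w) ^ k" for k
        by (induction k) (simp_all add: map_poly_1' cpoly_mult map_poly_pCons z_def
              del: mult_pCons_left mult_pCons_right)
      have "H \<epsilon> = of_real (\<epsilon> ^ n) * (poly (cpoly g) (z \<epsilon>) / poly (cpoly ([:- r, 1:] ^ n * f1)) (z \<epsilon>))"
        using that \<open>w \<noteq> 0\<close> by (simp add: cpoly_mult pw H_def power_mult_distrib divide_simps)
      then have "Im (H \<epsilon>) = \<epsilon> ^ n * Im (poly (cpoly g) (z \<epsilon>) / poly (cpoly ([:- r, 1:] ^ n * f1)) (z \<epsilon>))"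
        by (metis scaleR_conv_of_real scaleR_complex.sel(2))
      moreover have "Im (z \<epsilon>) > 0" using that w by (simp add: z_def)
      ultimately show ?thesis using im [of "z \<epsilon>"] that by (simp add: mult_nonneg_nonpos)
    qed
    then have "\<forall>\<^sub>F \<epsilon> in at_right 0. Im (H \<epsilon>) \<le> 0"
      by (auto simp: eventually_at_right_less eventually_at_filter)
    then have "Im (H 0) \<le> 0" using lim by (intro tendsto_upperbound) auto
    then show ?thesis by (simp add: H_def z_def poly_cpoly_of_real c_def)
  qed
  have "c \<noteq> 0" using g f1 by (simp add: c_def)
  \<comment> \<open>This angle makes \<open>w ^ n = \<i>\<close>, so the imaginary part of
    \<open>c / w ^ n\<close> is \<open>- c\<close>.\<close>
  have "pi / (2 * n) > 0" "pi / (2 * n) < pi" using n by (auto simp: field_simps)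
  then have "Im (cis (pi / (2 * n))) > 0" by (simp add: sin_gt_zero)
  moreover have "cis (pi / (2 * n)) ^ n = \<i>"
  proof -
    have "cis (pi / (2 * n)) ^ n = cis (real n * (pi / (2 * n)))" by (rule Complex.DeMoivre)
    also have "real n * (pi / (2 * n)) = pi / 2" using n by simp
    finally show ?thesis unfolding cis_pi_half .
  qed
  ultimately have "c \<ge> 0" using key [of "cis (pi / (2 * n))"] by simp
  then show "poly g r / poly f1 r \<ge> 0" by (simp add: c_def)
  show "n = 1"
  proof (rule ccontr)
    assume "n \<noteq> 1"
    then have "real n \<ge> 2" using n by simp
    \<comment> \<open>For \<open>n \<ge> 2\<close> the tripled angle is still below
      \<open>pi\<close>; there \<open>w ^ n = - \<i>\<close> and the sign of \<open>c\<close> is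
      reversed.\<close>
    then have "3 * pi / (2 * n) > 0" "3 * pi / (2 * n) < pi" using n by (auto simp: field_simps)
    then have "Im (cis (3 * pi / (2 * n))) > 0" by (simp add: sin_gt_zero)
    moreover have "cis (3 * pi / (2 * n)) ^ n = - \<i>"
    proof -
      have "cis (3 * pi / (2 * n)) ^ n = cis (real n * (3 * pi / (2 * n)))" by (rule Complex.DeMoivre)
      also have "real n * (3 * pi / (2 * n)) = pi + pi / 2" using n by simp
      also have "cis (pi + pi / 2) = - \<i>" unfolding cis_mult [symmetric] by simp
      finally show ?thesis .
    qed
    ultimately have "c \<le> 0" using key [of "cis (3 * pi / (2 * n))"] by simp
    with \<open>c \<ge> 0\<close> \<open>c \<noteq> 0\<close> show False by simp
  qed
qed

text \<open>Common real roots are cancelled by induction on the degree of \<open>f\<close>. Once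
  there are none, every root of \<open>f\<close> is a simple pole with nonnegative residue, so
  \<open>f\<close> has as many distinct roots as its degree, and Lagrange interpolation at these
  roots recovers \<open>g\<close>.\<close>

lemma nevanlinna_partial_fractions:
  fixes f g :: "real poly"
  assumes "f \<noteq> 0" "degree g < degree f \<or> g = 0"
    and "\<And>z. poly (cpoly f) z = 0 \<Longrightarrow> z \<in> \<real>"
    and "\<And>z. Im z > 0 \<Longrightarrow> Im (poly (cpoly g) z / poly (cpoly f) z) \<le> 0"
  shows "\<exists>R m. finite R \<and> (\<forall>r\<in>R. poly f r = 0 \<and> m r \<ge> 0) \<and>
      (\<forall>t. poly f t \<noteq> 0 \<longrightarrow> poly g t / poly f t = (\<Sum>r\<in>R. m r / (t - r)))"
  using assms
proof (induction "degree f" arbitrary: f g rule: less_induct)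
  case (less f g)
  show ?case
  proof (cases "\<exists>r. poly f r = 0 \<and> poly g r = 0")
    case True
    then obtain r f' g' where f': "f = [:- r, 1:] * f'" and g': "g = [:- r, 1:] * g'"
      by (metis poly_eq_0_iff_dvd dvdE)
    have "f' \<noteq> 0" using less.prems(1) f' by auto
    then have d: "degree f = Suc (degree f')" by (simp add: f' degree_mult_eq del: mult_pCons_left)
    have dg: "degree g' < degree f' \<or> g' = 0"
    proof (cases "g' = 0")
      case False
      then have "degree g = Suc (degree g')" by (simp add: g' degree_mult_eq del: mult_pCons_left)
      then show ?thesis using less.prems(2) d by auto
    qed simp
    have roots: "z \<in> \<real>" if "poly (cpoly f') z = 0" for z
      using less.prems(3) [of z] that by (simp add: f' cpoly_mult del: mult_pCons_left)
    have "Im (poly (cpoly g') z / poly (cpoly f') z) \<le> 0" if "Im z > 0" for z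
    proof -
      have "z - of_real r \<noteq> 0" using that by auto
      moreover have "poly (cpoly [:- r, 1:]) z = z - of_real r" by (simp add: map_poly_pCons)
      ultimately have "poly (cpoly g) z / poly (cpoly f) z = poly (cpoly g') z / poly (cpoly f') z"
        by (simp add: f' g' cpoly_mult del: mult_pCons_left)
      then show ?thesis using less.prems(4) [OF that] by simp
    qed
    then obtain R m where R: "finite R" "\<forall>r\<in>R. poly f' r = 0 \<and> m r \<ge> 0"
      "\<forall>t. poly f' t \<noteq> 0 \<longrightarrow> poly g' t / poly f' t = (\<Sum>r\<in>R. m r / (t - r))"
      using less.hyps [of f' g'] d \<open>f' \<noteq> 0\<close> dg roots by auto
    have "poly g t / poly f t = (\<Sum>r\<in>R. m r / (t - r))" if "poly f t \<noteq> 0" for t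
      using R(3) that by (simp add: f' g' del: mult_pCons_left)
    then show ?thesis using R by (intro exI [of _ R] exI [of _ m]) (auto simp: f' simp del: mult_pCons_left)
  next
    case False
    define R where "R = {r. poly f r = 0}"
    \<comment> \<open>\<open>F r\<close> is \<open>f\<close> without its factor at \<open>r\<close>,
      and \<open>m r\<close> will be the residue of \<open>g / f\<close> at
      \<open>r\<close>.\<close>
    define F where "F r = f div [:- r, 1:]" for r
    define m where "m r = poly g r / poly (F r) r" for r
    have fin: "finite R" using poly_roots_finite [OF less.prems(1)] by (simp add: R_def)
    have F: "f = [:- r, 1:] * F r" if "r \<in> R" for r
      using that by (simp add: R_def F_def poly_eq_0_iff_dvd del: mult_pCons_left)
    have simple: "order r f = 1 \<and> m r \<ge> 0 \<and> poly (F r) r \<noteq> 0" if r: "r \<in> R" for r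
    proof -
      obtain f1 where f1: "f = [:- r, 1:] ^ order r f * f1" "\<not> [:- r, 1:] dvd f1"
        using order_decomp [OF less.prems(1)] by blast
      have "order r f > 0" using r less.prems(1) by (simp add: R_def order_root)
      moreover have "poly g r \<noteq> 0" using False r by (auto simp: R_def)
      moreover have p1: "poly f1 r \<noteq> 0" using f1(2) by (simp add: poly_eq_0_iff_dvd)
      moreover have "Im (poly (cpoly g) z / poly (cpoly ([:- r, 1:] ^ order r f * f1)) z) \<le> 0"
        if "Im z > 0" for z
        using less.prems(4) [OF that] f1(1) by simp
      ultimately have *: "order r f = 1" "poly g r / poly f1 r \<ge> 0"
        using nevanlinna_pole_simple [of g r "order r f" f1] by auto
      then have "[:- r, 1:] * F r = [:- r, 1:] * f1" using f1(1) F [OF r] by simp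
      then have "F r = f1" by (simp del: mult_pCons_left)
      then show ?thesis using * p1 by (simp add: m_def)
    qed
    \<comment> \<open>Counting roots with multiplicity gives the degree; all orders are 1, so there
      are enough distinct interpolation nodes.\<close>
    have "degree f = size (proots f)"
      using size_proots_real_rooted less.prems(1,3) by simp
    also have "\<dots> = (\<Sum>r\<in>R. order r f)"
      using less.prems(1) by (simp add: size_multiset_overloaded_eq R_def)
    also have "\<dots> = card R" using simple by simp
    finally have card: "degree f = card R" .
    have dF: "degree (F r) < card R" if "r \<in> R" for r
    proof -
      have "F r \<noteq> 0" using F [OF that] less.prems(1) by auto
      then have "degree f = Suc (degree (F r))"
        by (subst F [OF that]) (simp add: degree_mult_eq del: mult_pCons_left)
      then show ?thesis using card by simp
    qed
    have g: "g = (\<Sum>r\<in>R. smult (m r) (F r))"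
    proof (cases "R = {}")
      case True
      then show ?thesis using card less.prems(2) by simp
    next
      case ne: False
      show ?thesis
      \<comment> \<open>Both sides have degree below \<open>card R\<close>. At a node
        \<open>r\<close> only the summand of \<open>r\<close> survives, since every other
        \<open>F r'\<close> still contains the factor that vanishes at \<open>r\<close>.\<close>
      proof (rule poly_eqI_degree [where A = R])
        fix r assume r: "r \<in> R"
        have "poly (F r') r = 0" if "r' \<in> R" "r' \<noteq> r" for r'
        proof -
          have "poly ([:- r', 1:] * F r') r = 0" using F [OF that(1)] r by (simp add: R_def)
          then show ?thesis using that by simp
        qed
        then have "poly (\<Sum>r\<in>R. smult (m r) (F r)) r = (\<Sum>r'\<in>{r}. m r' * poly (F r') r)"
          unfolding poly_sum poly_smult using fin r by (intro sum.mono_neutral_right) auto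
        then show "poly g r = poly (\<Sum>r\<in>R. smult (m r) (F r)) r"
          using simple [OF r] by (simp add: m_def)
      next
        show "card R > degree g"
          using less.prems(2) card ne fin by (auto simp: card_gt_0_iff)
        have "degree (\<Sum>r\<in>R. smult (m r) (F r)) \<le> card R - 1"
          using dF fin
          by (intro degree_sum_le) (fastforce intro: order.trans [OF degree_smult_le])+
        then show "card R > degree (\<Sum>r\<in>R. smult (m r) (F r))"
          using ne fin by (simp add: card_gt_0_iff less_eq_Suc_le [symmetric] Suc_le_eq)
            (metis Suc_pred card_gt_0_iff fin le_imp_less_Suc)
      qed
    qed
    have "poly g t / poly f t = (\<Sum>r\<in>R. m r / (t - r))" if t: "poly f t \<noteq> 0" for t
    proof -
      have "m r * poly (F r) t / poly f t = m r / (t - r)" if "r \<in> R" for r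
      proof -
        have "poly f t = (t - r) * poly (F r) t" by (subst F [OF that]) (simp add: algebra_simps)
        then show ?thesis using t by auto
      qed
      moreover have "poly g t = (\<Sum>r\<in>R. m r * poly (F r) t)" by (subst g) (simp add: poly_sum)
      ultimately show ?thesis by (simp add: sum_divide_distrib)
    qed
    then show ?thesis
      using fin simple by (intro exI [of _ R] exI [of _ m]) (auto simp: R_def)
  qed
qed

section \<open>The hyperbolicity cone\<close>

lemma norm_smult_vec: "norm (c *s z) = norm c * norm z" for z :: "complex ^ 'n"
  by (simp add: norm_vec_def norm_mult L2_set_right_distrib)

text \<open>The modulus of \<open>q\<close> at \<open>t\<close> is that of the leading coefficient
  times the distances from \<open>t\<close> to all roots. If every distance were at least
  \<open>\<rho>\<close>, the assumed bound would fail. This serves as a quantitative continuity of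
  roots.\<close>

lemma root_near:
  fixes q :: "complex poly"
  assumes "\<rho> > 0" "norm (poly q t) < norm (lead_coeff q) * \<rho> ^ degree q"
  shows "\<exists>r. poly q r = 0 \<and> norm (t - r) < \<rho>"
  using assms(2)
proof (induction "degree q" arbitrary: q)
  case 0
  then have "q = [:lead_coeff q:]" using degree_0_id [of q] by simp
  then have "poly q t = lead_coeff q" by (metis poly_const_conv)
  with 0 show ?case by simp
next
  case (Suc n)
  then have "\<not> constant (poly q)" by (simp add: constant_degree)
  then obtain r where r: "poly q r = 0" using fundamental_theorem_of_algebra by blast
  then obtain q' where q': "q = [:- r, 1:] * q'" by (auto simp: poly_eq_0_iff_dvd)
  have "q' \<noteq> 0" using Suc.hyps(2) q' by auto
  then have d: "degree q = Suc (degree q')" by (simp add: q' degree_mult_eq del: mult_pCons_left)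
  have lc: "lead_coeff q = lead_coeff q'"
    by (simp add: q' lead_coeff_mult del: mult_pCons_left)
  show ?case
  proof (cases "norm (t - r) < \<rho>")
    case True
    then show ?thesis using r by blast
  next
    case False
    have "\<rho> * norm (poly q' t) \<le> norm (t - r) * norm (poly q' t)"
      using False by (intro mult_right_mono) auto
    also have "\<dots> = norm (poly q t)" by (simp add: q' norm_mult [symmetric] algebra_simps)
    also have "\<dots> < norm (lead_coeff q) * \<rho> ^ degree q" by (rule Suc.prems)
    also have "\<dots> = \<rho> * (norm (lead_coeff q') * \<rho> ^ degree q')" unfolding lc by (simp add: d)
    finally have "norm (poly q' t) < norm (lead_coeff q') * \<rho> ^ degree q'"
      using assms(1) by simp
    then obtain r' where "poly q' r' = 0" "norm (t - r') < \<rho>"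
      using Suc.hyps d by force
    then show ?thesis by (auto simp: q' simp del: mult_pCons_left)
  qed
qed

section \<open>The open cone of points with positive eigenvalues\<close>

locale hyperbolic_poly =
  fixes p :: "('n::finite) rmpoly" and d :: nat and e :: "real ^ 'n"
  assumes hom: "homogeneous d p" and hyp: "hyperbolic p e"
begin

text \<open>A zero of \<open>p\<close> at \<open>x + s e\<close> means, by homogeneity, that
  \<open>- s\<close> is an eigenvalue of \<open>x\<close>. Excluding all \<open>s \<ge> 0\<close>
  says that every eigenvalue is positive without listing the roots.\<close>

definition pos_cone :: "(real ^ 'n) set" where
  "pos_cone = {x. \<forall>s\<ge>0. mp_eval p (x + s *\<^sub>R e) \<noteq> 0}"

lemma eval_e_pos: "mp_eval p e > 0"
  using hyp by (simp add: hyperbolic_def)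

text \<open>Homogeneity allows the substitution \<open>\<theta> = s / (1 + s)\<close>, which
  replaces the ray by a compact segment ending at \<open>e\<close>.\<close>

lemma pos_cone_segment:
  "x \<in> pos_cone \<longleftrightarrow> (\<forall>\<theta>\<in>{0..1}. mp_eval p ((1 - \<theta>) *\<^sub>R x + \<theta> *\<^sub>R e) \<noteq> 0)"
proof (intro iffI ballI)
  fix \<theta> :: real assume x: "x \<in> pos_cone" and \<theta>: "\<theta> \<in> {0..1}"
  show "mp_eval p ((1 - \<theta>) *\<^sub>R x + \<theta> *\<^sub>R e) \<noteq> 0"
  proof (cases "\<theta> = 1")
    case True
    then show ?thesis using eval_e_pos by simp
  next
    case False
    then have "(1 - \<theta>) *\<^sub>R x + \<theta> *\<^sub>R e = (1 - \<theta>) *\<^sub>R (x + (\<theta> / (1 - \<theta>)) *\<^sub>R e)"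
      by (simp add: scaleR_add_right)
    moreover have "mp_eval p (x + (\<theta> / (1 - \<theta>)) *\<^sub>R e) \<noteq> 0"
      using x \<theta> by (simp add: pos_cone_def)
    ultimately show ?thesis using False by (simp add: mp_eval_scaleR [OF hom])
  qed
next
  assume *: "\<forall>\<theta>\<in>{0..1}. mp_eval p ((1 - \<theta>) *\<^sub>R x + \<theta> *\<^sub>R e) \<noteq> 0"
  have "mp_eval p (x + s *\<^sub>R e) \<noteq> 0" if "s \<ge> 0" for s
  proof -
    have "mp_eval p ((1 - s / (1 + s)) *\<^sub>R x + (s / (1 + s)) *\<^sub>R e) \<noteq> 0"
      using that by (intro bspec [OF *]) (auto simp: field_simps)
    moreover have "x + s *\<^sub>R e = (1 + s) *\<^sub>R ((1 - s / (1 + s)) *\<^sub>R x + (s / (1 + s)) *\<^sub>R e)"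
    proof -
      have "(1 + s) * (1 - s / (1 + s)) = 1" "(1 + s) * (s / (1 + s)) = s"
        using that by (auto simp: field_simps)
      then show ?thesis by (simp add: scaleR_add_right)
    qed
    ultimately show ?thesis using that by (simp add: mp_eval_scaleR [OF hom])
  qed
  then show "x \<in> pos_cone" by (simp add: pos_cone_def)
qed

text \<open>The complement is the projection of a closed set along the compact interval
  \<open>{0..1}\<close>.\<close>

lemma open_pos_cone: "open pos_cone"
proof -
  define T where "T = {z :: real \<times> (real ^ 'n). mp_eval p ((1 - fst z) *\<^sub>R snd z + fst z *\<^sub>R e) = 0}"
  have "closed T"
    unfolding T_def by (intro closed_Collect_eq continuous_intros)
  then have "closed {x. \<exists>\<theta>. \<theta> \<in> {0..1} \<and> (\<theta>, x) \<in> T}"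
    by (intro closed_compact_projection) auto
  moreover have "- pos_cone = {x. \<exists>\<theta>. \<theta> \<in> {0..1} \<and> (\<theta>, x) \<in> T}"
    by (auto simp: pos_cone_segment T_def Bex_def)
  ultimately have "closed (- pos_cone)" by (simp only:)
  then show ?thesis by (simp add: closed_def)
qed

lemma eval_pos:
  assumes "x \<in> pos_cone"
  shows "mp_eval p x > 0"
proof (rule ccontr)
  assume "\<not> mp_eval p x > 0"
  then have "\<exists>\<theta>\<ge>0. \<theta> \<le> 1 \<and> mp_eval p ((1 - \<theta>) *\<^sub>R x + \<theta> *\<^sub>R e) = 0"
    using eval_e_pos by (intro IVT' continuous_intros) auto
  then show False using assms by (auto simp: pos_cone_segment)
qed

lemma e_in_pos_cone: "e \<in> pos_cone"
  using eval_e_pos by (simp add: pos_cone_segment algebra_simps)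

lemma pos_cone_scaleR:
  assumes "x \<in> pos_cone" "c > 0"
  shows "c *\<^sub>R x \<in> pos_cone"
  unfolding pos_cone_def
proof (intro CollectI allI impI)
  fix s :: real assume "s \<ge> 0"
  then have "mp_eval p (x + (s / c) *\<^sub>R e) \<noteq> 0"
    using assms by (simp add: pos_cone_def)
  moreover have "c *\<^sub>R x + s *\<^sub>R e = c *\<^sub>R (x + (s / c) *\<^sub>R e)"
    using assms by (simp add: scaleR_add_right)
  ultimately show "mp_eval p (c *\<^sub>R x + s *\<^sub>R e) \<noteq> 0"
    using assms by (simp add: mp_eval_scaleR [OF hom])
qed

lemma open_pos_cone_line: "open {t. x + t *\<^sub>R u \<in> pos_cone}"
proof -
  have "open ((\<lambda>t. x + t *\<^sub>R u) -` pos_cone)"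
    by (intro open_vimage open_pos_cone continuous_intros)
  then show ?thesis by (simp add: vimage_def)
qed

lemma pos_cone_line:
  assumes "x \<in> pos_cone"
  shows "\<exists>\<epsilon>>0. \<forall>t. \<bar>t\<bar> \<le> \<epsilon> \<longrightarrow> x + t *\<^sub>R u \<in> pos_cone"
proof -
  have "0 \<in> {t. x + t *\<^sub>R u \<in> pos_cone}" using assms by simp
  then obtain \<epsilon> where "\<epsilon> > 0" "cball 0 \<epsilon> \<subseteq> {t. x + t *\<^sub>R u \<in> pos_cone}"
    using open_pos_cone_line open_contains_cball by blast
  then show ?thesis by (intro exI [of _ \<epsilon>]) (force simp: dist_norm)
qed

lemma pos_cone_shift:
  assumes "x \<in> pos_cone"
  obtains \<epsilon> where "\<epsilon> > 0" "x - \<epsilon> *\<^sub>R e \<in> pos_cone"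
proof -
  obtain \<epsilon> where \<epsilon>: "\<epsilon> > 0" "\<forall>t. \<bar>t\<bar> \<le> \<epsilon> \<longrightarrow> x + t *\<^sub>R e \<in> pos_cone"
    using pos_cone_line [OF assms, of e] by blast
  have "x + (- \<epsilon>) *\<^sub>R e \<in> pos_cone"
    by (rule \<epsilon>(2) [rule_format]) (use \<epsilon>(1) in simp)
  then show ?thesis using that [OF \<epsilon>(1)] by simp
qed

text \<open>Zero-freeness for imaginary parts in the half-open sector spanned by \<open>e\<close>
  and \<open>c\<close>. The strictly positive multiple of \<open>e\<close> makes the case
  \<open>c = 0\<close> equivalent to plain hyperbolicity, from which points of the cone are added
  one by one.\<close>

definition tube :: "real ^ 'n \<Rightarrow> bool" where
  "tube c \<longleftrightarrow> (\<forall>\<alpha>>0. \<forall>s\<ge>0. \<forall>x. mp_ceval p (cvec x + \<i> *s cvec (\<alpha> *\<^sub>R e + s *\<^sub>R c)) \<noteq> 0)"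

lemma tubeD:
  "tube c \<Longrightarrow> \<alpha> > 0 \<Longrightarrow> s \<ge> 0 \<Longrightarrow>
    mp_ceval p (cvec x + \<i> *s cvec (\<alpha> *\<^sub>R e + s *\<^sub>R c)) \<noteq> 0"
  unfolding tube_def by simp

lemma ceval_e: "\<alpha> \<noteq> 0 \<Longrightarrow> mp_ceval p (cvec x + (\<i> * complex_of_real \<alpha>) *s cvec e) \<noteq> 0"
  using hyperbolic_ceval [OF hyp, of "\<i> * complex_of_real \<alpha>" x]
  by (auto simp: add.commute complex_is_Real_iff)

lemma tube_0: "tube 0"
  unfolding tube_def
proof (intro allI impI)
  fix \<alpha> s :: real and x :: "real ^ 'n" assume "\<alpha> > 0"
  then have "mp_ceval p (cvec x + (\<i> * complex_of_real \<alpha>) *s cvec e) \<noteq> 0"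
    by (intro ceval_e) auto
  then show "mp_ceval p (cvec x + \<i> *s cvec (\<alpha> *\<^sub>R e + s *\<^sub>R 0)) \<noteq> 0"
    by (simp add: cvec_simps vector_smult_assoc)
qed

text \<open>The roots \<open>t\<close> of \<open>p (t b + s (x + \<i> c) + \<i> \<alpha> e)\<close> lie in the open lower half-plane for \<open>s = 0\<close>,
  and they cannot cross the real axis while \<open>s\<close> runs from \<open>0\<close> to \<open>1\<close>.\<close>

lemma tube_step:
  assumes tube: "tube c" and b: "b \<in> pos_cone" and \<alpha>: "\<alpha> > 0" and t: "Im t \<ge> 0"
  shows "mp_ceval p (t *s cvec b + (cvec x + \<i> *s cvec (\<alpha> *\<^sub>R e + c))) \<noteq> 0"
proof -
  define W where "W s = cvec (s *\<^sub>R x) + \<i> *s cvec (\<alpha> *\<^sub>R e + s *\<^sub>R c)" for s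
  define Q where "Q s = mp_subst (\<lambda>c. [:complex_of_real c:]) p (\<lambda>i. [:W s $ i, complex_of_real (b $ i):])" for s
  have Q: "poly (Q s) t = mp_ceval p (t *s cvec b + W s)" for s t
    unfolding Q_def mp_ceval_def
    by (subst mp_subst_hom [where \<psi> = "\<lambda>B. poly B t"]) (auto simp: algebra_simps intro: mp_subst_cong)
  have pb: "mp_eval p b > 0" using b by (rule eval_pos)
  \<comment> \<open>Degree and leading coefficient do not depend on \<open>s\<close>, so
    \<open>root_near\<close> can be applied with one threshold for all \<open>s\<close>.\<close>
  have "coeff (Q s) d = complex_of_real (mp_eval p b)" for s
    using mp_subst_linear_degree(2) [OF hom, of complex_of_real "\<lambda>i. W s $ i"]
      mp_ceval_cvec [of p b] by (simp add: Q_def mp_ceval_def)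
  moreover have "degree (Q s) \<le> d" for s
    unfolding Q_def by (rule mp_subst_linear_degree(1) [OF hom])
  ultimately have deg: "degree (Q s) = d" and lc: "lead_coeff (Q s) = complex_of_real (mp_eval p b)" for s
    using pb by (metis le_antisym le_degree of_real_eq_0_iff less_irrefl)+
  have contW: "continuous_on S W" for S
    unfolding W_def cvec_def by (intro continuous_intros)
  have contP: "continuous_on S (\<lambda>z. mp_ceval p (fst z *s cvec b + W (snd z)))" for S
  proof -
    have "continuous_on S (\<lambda>z. W (snd z))"
      by (rule continuous_on_compose2 [OF contW [of UNIV]]) (auto intro: continuous_intros)
    then show ?thesis by (intro continuous_intros)
  qed
  \<comment> \<open>The bad parameters. \<open>A\<close> omits 0 and is both open and closed in the
    connected interval, hence empty.\<close>
  define A where "A = {s \<in> {0..1}. \<exists>t. Im t \<ge> 0 \<and> mp_ceval p (t *s cvec b + W s) = 0}"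
  have real_free: "Im t \<noteq> 0" if "mp_ceval p (t *s cvec b + W s) = 0" "s \<in> {0..1}" for t s
  proof
    assume "Im t = 0"
    then have "t = complex_of_real (Re t)" by (simp add: complex_eq_iff)
    then have "t *s cvec b + W s =
        cvec (Re t *\<^sub>R b + s *\<^sub>R x) + \<i> *s cvec (\<alpha> *\<^sub>R e + s *\<^sub>R c)"
      unfolding W_def cvec_simps by (metis add.assoc)
    then show False using tube that \<alpha> by (auto simp: tube_def)
  qed
  have "0 \<notin> A"
  proof
    assume "0 \<in> A"
    then obtain t where t: "Im t \<ge> 0" "mp_ceval p (t *s cvec b + W 0) = 0" by (auto simp: A_def)
    have W0: "W 0 = (\<i> * complex_of_real \<alpha>) *s cvec e"
      by (simp add: W_def cvec_simps vector_smult_assoc)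
    have "t \<noteq> 0" using real_free [OF t(2)] by auto
    \<comment> \<open>Dividing by \<open>t\<close> turns the root into a zero of
      \<open>p (b + z e)\<close>. Hyperbolicity makes \<open>z\<close> real and
      \<open>b \<in> pos_cone\<close> makes it negative, so \<open>t = \<i> \<alpha> / z\<close>
      lies in the lower half-plane.\<close>
    define z where "z = \<i> * complex_of_real \<alpha> / t"
    have "t *s cvec b + W 0 = t *s (z *s cvec e + cvec b)"
      using \<open>t \<noteq> 0\<close> by (simp add: W0 z_def vec_eq_iff field_simps)
    then have 0: "mp_ceval p (z *s cvec e + cvec b) = 0"
      using mp_ceval_smult [OF hom, of t "z *s cvec e + cvec b"] t(2) \<open>t \<noteq> 0\<close>
      by (metis mult_eq_0_iff power_not_zero)
    then have "z \<in> \<real>" by (rule hyperbolic_ceval [OF hyp])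
    then obtain r where r: "z = complex_of_real r" by (auto elim: Reals_cases)
    have "z *s cvec e + cvec b = cvec (b + r *\<^sub>R e)" by (simp add: cvec_simps r add.commute)
    then have "mp_eval p (b + r *\<^sub>R e) = 0" using 0 by (simp add: mp_ceval_cvec)
    then have "r < 0" using b by (cases "r < 0") (auto simp: pos_cone_def)
    have "z \<noteq> 0" using \<open>t \<noteq> 0\<close> \<alpha> by (simp add: z_def)
    then have "t = \<i> * complex_of_real \<alpha> / z" using \<open>t \<noteq> 0\<close> by (simp add: z_def)
    then have "Im t = \<alpha> / r" by (simp add: r Im_divide_of_real)
    then show False using t(1) \<open>r < 0\<close> \<alpha> by (simp add: zero_le_divide_iff)
  qed
  moreover have "closed A"
  proof -
    have "continuous (at (cvec b)) (mp_ceval p)"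
      using continuous_on_mp_ceval [OF continuous_on_id, of UNIV p]
      by (simp add: continuous_on_eq_continuous_at)
    moreover have "mp_ceval p (cvec b) \<noteq> 0" using pb by (simp add: mp_ceval_cvec)
    ultimately obtain \<delta> where \<delta>: "\<delta> > 0" "\<And>z. dist (cvec b) z < \<delta> \<Longrightarrow> mp_ceval p z \<noteq> 0"
      using continuous_at_avoid by metis
    have "compact (W ` {0..1})" by (intro compact_continuous_image contW) auto
    then obtain M where M: "\<And>s. s \<in> {0..1} \<Longrightarrow> norm (W s) \<le> M"
      using compact_imp_bounded bounded_iff by (metis imageI)
    \<comment> \<open>A larger root would, after division by \<open>t\<close>, give a zero of
      \<open>p\<close> within \<open>\<delta>\<close> of \<open>b\<close>. With the roots confined
      to a compact ball, \<open>A\<close> is the projection of a closed set along that ball.\<close>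
    have bd: "norm t \<le> M / \<delta>" if "s \<in> {0..1}" "mp_ceval p (t *s cvec b + W s) = 0" for s t
    proof (rule ccontr)
      assume *: "\<not> norm t \<le> M / \<delta>"
      have "M \<ge> 0" using M [OF that(1)] norm_ge_zero order.trans by blast
      then have "norm t > 0" using * \<delta>(1) by (smt (verit) divide_nonneg_pos)
      then have "t \<noteq> 0" by auto
      have "t *s cvec b + W s = t *s (cvec b + (1 / t) *s W s)"
        using \<open>t \<noteq> 0\<close> by (simp add: vec_eq_iff field_simps)
      then have "mp_ceval p (cvec b + (1 / t) *s W s) = 0"
        using mp_ceval_smult [OF hom, of t "cvec b + (1 / t) *s W s"] that(2) \<open>t \<noteq> 0\<close>
        by (metis mult_eq_0_iff power_not_zero)
      then have "\<delta> \<le> dist (cvec b) (cvec b + (1 / t) *s W s)" using \<delta>(2) by force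
      also have "\<dots> = norm (W s) / norm t"
        by (simp add: dist_norm norm_smult_vec norm_divide)
      also have "\<dots> \<le> M / norm t" using M [OF that(1)] by (intro divide_right_mono) auto
      finally show False using * \<delta>(1) \<open>norm t > 0\<close> by (simp add: field_simps)
    qed
    define T where "T = {z :: complex \<times> real. snd z \<in> {0..1} \<and> Im (fst z) \<ge> 0 \<and>
        mp_ceval p (fst z *s cvec b + W (snd z)) = 0}"
    have "T = (UNIV \<times> {0..1}) \<inter> {z. Im (fst z) \<ge> 0} \<inter> {z. mp_ceval p (fst z *s cvec b + W (snd z)) = 0}"
      by (auto simp: T_def)
    moreover have "closed \<dots>"
      by (intro closed_Int closed_Times closed_Collect_le closed_Collect_eq contP continuous_intros)
    ultimately have "closed T" by simp
    then have "closed {s. \<exists>t. t \<in> cball 0 (M / \<delta>) \<and> (t, s) \<in> T}"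
      by (intro closed_compact_projection) auto
    moreover have "A = {s. \<exists>t. t \<in> cball 0 (M / \<delta>) \<and> (t, s) \<in> T}"
      using bd by (auto simp: A_def T_def)
    ultimately show ?thesis by simp
  qed
  moreover have "openin (top_of_set {0..1}) A"
    unfolding openin_contains_ball
  proof (intro conjI ballI)
    fix s0 assume s0: "s0 \<in> A"
    then obtain t0 where t0: "Im t0 \<ge> 0" "mp_ceval p (t0 *s cvec b + W s0) = 0"
      by (auto simp: A_def)
    then have "Im t0 > 0" using real_free [OF t0(2)] s0 by (auto simp: A_def)
    \<comment> \<open>This is the threshold of \<open>root_near\<close> for the radius
      \<open>Im t0\<close>: for \<open>s\<close> near \<open>s0\<close> some root stays within that
      distance of \<open>t0\<close> and so keeps a nonnegative imaginary part.\<close>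
    define \<rho> where "\<rho> = mp_eval p b * Im t0 ^ d"
    have "\<rho> > 0" using pb \<open>Im t0 > 0\<close> by (simp add: \<rho>_def)
    have "continuous_on UNIV (\<lambda>s. norm (mp_ceval p (t0 *s cvec b + W s)))"
      by (intro continuous_intros contW)
    then have "open {s. norm (mp_ceval p (t0 *s cvec b + W s)) < \<rho>}"
      by (intro open_Collect_less continuous_on_const)
    moreover have "s0 \<in> {s. norm (mp_ceval p (t0 *s cvec b + W s)) < \<rho>}"
      using t0 \<open>\<rho> > 0\<close> by simp
    ultimately obtain \<epsilon> where \<epsilon>: "\<epsilon> > 0" "ball s0 \<epsilon> \<subseteq> {s. norm (mp_ceval p (t0 *s cvec b + W s)) < \<rho>}"
      using open_contains_ball by blast
    have "s \<in> A" if "s \<in> ball s0 \<epsilon> \<inter> {0..1}" for s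
    proof -
      have "norm (poly (Q s) t0) < norm (lead_coeff (Q s)) * Im t0 ^ degree (Q s)"
        using that \<epsilon>(2) pb unfolding lc unfolding Q deg by (auto simp: \<rho>_def)
      then obtain r where r: "poly (Q s) r = 0" "norm (t0 - r) < Im t0"
        using root_near \<open>Im t0 > 0\<close> by blast
      have "Im t0 - Im r \<le> norm (t0 - r)"
        using abs_Im_le_cmod [of "t0 - r"] by simp
      then have "Im r \<ge> 0" using r(2) by linarith
      then show ?thesis using r(1) that by (auto simp: A_def Q)
    qed
    then show "\<exists>\<epsilon>>0. ball s0 \<epsilon> \<inter> {0..1} \<subseteq> A" using \<epsilon>(1) by blast
  qed (auto simp: A_def)
  moreover have "closedin (top_of_set {0..1}) A"
    using \<open>closed A\<close> by (rule closed_subset [rotated]) (auto simp: A_def)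
  ultimately have "A = {} \<or> A = {0..1}"
    using connected_Icc [of 0 "1::real"] unfolding connected_clopen by blast
  then have "A = {}" using \<open>0 \<notin> A\<close> by auto
  then have "1 \<notin> A" by simp
  then show ?thesis using t by (auto simp: A_def W_def)
qed

text \<open>The \<open>tube\<close> property passes to \<open>s c\<close> for
  \<open>s \<ge> 0\<close>; \<open>tube_step\<close> at \<open>t = \<i> s\<close> then contributes
  the missing imaginary part \<open>s b\<close>.\<close>

lemma tube_add:
  assumes "tube c" "b \<in> pos_cone"
  shows "tube (c + b)"
  unfolding tube_def
proof (intro allI impI)
  fix \<alpha> s :: real and x :: "real ^ 'n" assume \<alpha>: "\<alpha> > 0" and s: "s \<ge> 0"
  have "tube (s *\<^sub>R c)"
    unfolding tube_def
  proof (intro allI impI)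
    fix \<alpha> s' :: real and x :: "real ^ 'n" assume "\<alpha> > 0" "s' \<ge> 0"
    then show "mp_ceval p (cvec x + \<i> *s cvec (\<alpha> *\<^sub>R e + s' *\<^sub>R s *\<^sub>R c)) \<noteq> 0"
      using assms(1) s by (simp add: tube_def)
  qed
  then have "mp_ceval p ((\<i> * complex_of_real s) *s cvec b + (cvec x + \<i> *s cvec (\<alpha> *\<^sub>R e + s *\<^sub>R c))) \<noteq> 0"
    using s \<alpha> by (intro tube_step assms) auto
  moreover have "(\<i> * complex_of_real s) *s cvec b + (cvec x + \<i> *s cvec (\<alpha> *\<^sub>R e + s *\<^sub>R c)) =
      cvec x + \<i> *s cvec (\<alpha> *\<^sub>R e + s *\<^sub>R (c + b))"
    by (simp add: vec_eq_iff algebra_simps)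
  ultimately show "mp_ceval p (cvec x + \<i> *s cvec (\<alpha> *\<^sub>R e + s *\<^sub>R (c + b))) \<noteq> 0" by simp
qed

text \<open>Openness leaves room to write \<open>a\<close> as \<open>\<epsilon> e\<close> plus
  another point of the cone; the first term is the positive multiple of \<open>e\<close> that
  \<open>tube\<close> demands.\<close>

lemma ceval_nonzero:
  assumes "a \<in> pos_cone"
  shows "mp_ceval p (cvec x + \<i> *s cvec a) \<noteq> 0"
proof -
  obtain \<epsilon> where \<epsilon>: "\<epsilon> > 0" "a - \<epsilon> *\<^sub>R e \<in> pos_cone"
    by (rule pos_cone_shift [OF assms])
  from \<epsilon>(2) have "tube (0 + (a - \<epsilon> *\<^sub>R e))"
    by (rule tube_add [OF tube_0])
  then have "mp_ceval p (cvec x + \<i> *s cvec (\<epsilon> *\<^sub>R e + 1 *\<^sub>R (0 + (a - \<epsilon> *\<^sub>R e)))) \<noteq> 0"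
    by (rule tubeD) (use \<epsilon>(1) in auto)
  then show ?thesis by simp
qed

text \<open>At a purely imaginary vector \<open>\<i> y\<close> the value of \<open>p\<close> is
  \<open>\<i> ^ d\<close> times its value at \<open>y\<close>. Hence the \<open>tube\<close>
  property of the sum, with \<open>\<epsilon> e\<close> set aside as before, excludes real zeros on
  the ray from \<open>a + b\<close>.\<close>

lemma pos_cone_add:
  assumes a: "a \<in> pos_cone" and b: "b \<in> pos_cone"
  shows "a + b \<in> pos_cone"
proof -
  obtain \<epsilon> where \<epsilon>: "\<epsilon> > 0" "a - \<epsilon> *\<^sub>R e \<in> pos_cone"
    by (rule pos_cone_shift [OF a])
  from \<epsilon>(2) have tube: "tube (0 + (a - \<epsilon> *\<^sub>R e) + b)"
    by (rule tube_add [OF tube_add [OF tube_0] b])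
  have "mp_eval p (a + b + s *\<^sub>R e) \<noteq> 0" if "s \<ge> 0" for s
  proof
    assume 0: "mp_eval p (a + b + s *\<^sub>R e) = 0"
    have eq: "(\<epsilon> + s) *\<^sub>R e + 1 *\<^sub>R (0 + (a - \<epsilon> *\<^sub>R e) + b) = a + b + s *\<^sub>R e"
      by (simp add: algebra_simps)
    have "mp_ceval p (cvec 0 + \<i> *s cvec ((\<epsilon> + s) *\<^sub>R e + 1 *\<^sub>R (0 + (a - \<epsilon> *\<^sub>R e) + b))) \<noteq> 0"
      using that \<epsilon>(1) by (intro tubeD tube) auto
    then have "mp_ceval p (cvec 0 + \<i> *s cvec (a + b + s *\<^sub>R e)) \<noteq> 0"
      unfolding eq .
    then show False
      using 0 by (simp add: cvec_simps(5) mp_ceval_smult [OF hom] mp_ceval_cvec)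
  qed
  then show ?thesis by (simp add: pos_cone_def)
qed

text \<open>Forwards, some \<open>y\<close> in the cone is so close to \<open>x\<close> that
  \<open>x - y + s e\<close> is in the cone too, and the two points add up. Backwards, let
  \<open>s\<close> tend to 0.\<close>

lemma closure_pos_cone_iff: "x \<in> closure pos_cone \<longleftrightarrow> (\<forall>s>0. x + s *\<^sub>R e \<in> pos_cone)"
proof (intro iffI allI impI)
  fix s :: real assume x: "x \<in> closure pos_cone" and s: "s > 0"
  define U where "U = (\<lambda>y. x - y + s *\<^sub>R e) -` pos_cone"
  have "open U"
    unfolding U_def by (intro open_vimage open_pos_cone continuous_intros)
  moreover have "x \<in> U \<inter> closure pos_cone"
    using s x by (simp add: U_def pos_cone_scaleR e_in_pos_cone)
  ultimately have "U \<inter> pos_cone \<noteq> {}"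
    by (metis empty_iff open_Int_closure_eq_empty)
  then obtain y where y: "y \<in> pos_cone" "x - y + s *\<^sub>R e \<in> pos_cone"
    by (auto simp: U_def)
  from pos_cone_add [OF this] show "x + s *\<^sub>R e \<in> pos_cone"
    by (simp add: algebra_simps)
next
  assume *: "\<forall>s>0. x + s *\<^sub>R e \<in> pos_cone"
  have "((\<lambda>s. x + s *\<^sub>R e) \<longlongrightarrow> x + 0 *\<^sub>R e) (at_right 0)"
    by (intro tendsto_intros)
  moreover have "\<forall>\<^sub>F s in at_right 0. x + s *\<^sub>R e \<in> closure pos_cone"
    by (rule eventually_mono [OF eventually_at_right_less]) (use * closure_subset [of pos_cone] in blast)
  ultimately have "x + 0 *\<^sub>R e \<in> closure pos_cone"
    by (intro Lim_in_closed_set) auto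
  then show "x \<in> closure pos_cone" by simp
qed

text \<open>A small multiple of \<open>e\<close> is moved from \<open>a\<close>, which can spare it,
  to \<open>v\<close>, which it pushes into the open cone.\<close>

lemma closure_add_pos_cone:
  assumes "v \<in> closure pos_cone" "a \<in> pos_cone"
  shows "a + v \<in> pos_cone"
proof -
  obtain \<epsilon> where \<epsilon>: "\<epsilon> > 0" "a - \<epsilon> *\<^sub>R e \<in> pos_cone"
    by (rule pos_cone_shift [OF assms(2)])
  have "v + \<epsilon> *\<^sub>R e \<in> pos_cone" using assms(1) \<epsilon>(1) by (simp add: closure_pos_cone_iff)
  with \<epsilon>(2) have "(a - \<epsilon> *\<^sub>R e) + (v + \<epsilon> *\<^sub>R e) \<in> pos_cone"
    by (rule pos_cone_add)
  then show ?thesis by (simp add: algebra_simps)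
qed

lemma closure_pos_cone_add:
  assumes "v \<in> closure pos_cone" "w \<in> closure pos_cone"
  shows "v + w \<in> closure pos_cone"
  unfolding closure_pos_cone_iff
proof (intro allI impI)
  fix s :: real assume "s > 0"
  then have "w + s *\<^sub>R e \<in> pos_cone" using assms(2) by (simp add: closure_pos_cone_iff)
  then have "(w + s *\<^sub>R e) + v \<in> pos_cone"
    by (rule closure_add_pos_cone [OF assms(1)])
  then show "v + w + s *\<^sub>R e \<in> pos_cone" by (simp add: algebra_simps)
qed

lemma zero_in_closure: "0 \<in> closure pos_cone"
  by (simp add: closure_pos_cone_iff pos_cone_scaleR e_in_pos_cone)

lemma closure_pos_cone_scaleR:
  assumes "v \<in> closure pos_cone" "c \<ge> 0"
  shows "c *\<^sub>R v \<in> closure pos_cone"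
proof (cases "c = 0")
  case False
  show ?thesis
    unfolding closure_pos_cone_iff
  proof (intro allI impI)
    fix s :: real assume "s > 0"
    then have "c *\<^sub>R (v + (s / c) *\<^sub>R e) \<in> pos_cone"
      using assms False by (intro pos_cone_scaleR) (auto simp: closure_pos_cone_iff)
    then show "c *\<^sub>R v + s *\<^sub>R e \<in> pos_cone" using False by (simp add: scaleR_add_right)
  qed
qed (simp add: zero_in_closure)

text \<open>An interior point stays in the closure after subtracting some
  \<open>\<epsilon> e\<close>; adding it back lands in the open cone.\<close>

lemma interior_closure_pos_cone: "interior (closure pos_cone) = pos_cone"
proof
  show "pos_cone \<subseteq> interior (closure pos_cone)"
    by (intro interior_maximal closure_subset open_pos_cone)
  show "interior (closure pos_cone) \<subseteq> pos_cone"
  proof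
    fix x assume x: "x \<in> interior (closure pos_cone)"
    have "open ((\<lambda>s. x - s *\<^sub>R e) -` interior (closure pos_cone))"
      by (intro open_vimage open_interior continuous_intros)
    moreover have "0 \<in> (\<lambda>s. x - s *\<^sub>R e) -` interior (closure pos_cone)" using x by simp
    ultimately obtain \<epsilon> where "\<epsilon> > 0" "cball 0 \<epsilon> \<subseteq> (\<lambda>s. x - s *\<^sub>R e) -` interior (closure pos_cone)"
      using open_contains_cball by blast
    then have "\<epsilon> \<in> (\<lambda>s. x - s *\<^sub>R e) -` interior (closure pos_cone)"
      by (rule_tac subsetD) (auto simp: dist_norm)
    then have "x - \<epsilon> *\<^sub>R e \<in> closure pos_cone"
      using interior_subset [of "closure pos_cone"] by blast
    then have "x - \<epsilon> *\<^sub>R e + \<epsilon> *\<^sub>R e \<in> pos_cone"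
      using \<open>\<epsilon> > 0\<close> by (simp only: closure_pos_cone_iff)
    then show "x \<in> pos_cone" by simp
  qed
qed

lemma convex_cone_closure: "convex_cone (closure pos_cone)"
  unfolding convex_cone_iff
  using closure_pos_cone_add closure_pos_cone_scaleR zero_in_closure by blast

text \<open>Hyperbolicity in every direction of the cone. Multiplication by the sign of
  \<open>Im z\<close> turns the imaginary part into a positive multiple of \<open>a\<close>, where
  \<open>ceval_nonzero\<close> applies.\<close>

lemma real_rooted_line_poly:
  assumes a: "a \<in> pos_cone" and z: "poly (cpoly (line_poly p a u)) z = 0"
  shows "z \<in> \<real>"
proof (rule ccontr)
  assume "z \<notin> \<real>"
  then have "Im z \<noteq> 0" by (simp add: complex_is_Real_iff)
  define c where "c = sgn (Im z)"
  have "complex_of_real c *s (z *s cvec a - cvec u) =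
      cvec (c *\<^sub>R (Re z *\<^sub>R a - u)) + \<i> *s cvec (\<bar>Im z\<bar> *\<^sub>R a)"
    by (simp add: vec_eq_iff complex_eq_iff c_def algebra_simps abs_sgn)
  moreover have "mp_ceval p \<dots> \<noteq> 0"
    using \<open>Im z \<noteq> 0\<close> by (intro ceval_nonzero pos_cone_scaleR a) auto
  ultimately have "mp_ceval p (complex_of_real c *s (z *s cvec a - cvec u)) \<noteq> 0" by simp
  then have "mp_ceval p (z *s cvec a - cvec u) \<noteq> 0"
    unfolding mp_ceval_smult [OF hom] by simp
  then show False using z by (simp add: poly_cpoly_line_poly)
qed

lemma line_poly_degree_eq:
  assumes "a \<in> pos_cone"
  shows "degree (line_poly p a u) = d" "lead_coeff (line_poly p a u) = mp_eval p a"
proof -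
  show "degree (line_poly p a u) = d"
    using degree_line_poly [OF hom, of a u] eval_pos [OF assms] le_degree [of "line_poly p a u" d]
    by auto
  then show "lead_coeff (line_poly p a u) = mp_eval p a"
    using degree_line_poly(2) [OF hom, of a u] by simp
qed

end

section \<open>Derivatives of logarithms of polynomial functions\<close>

text \<open>The direction precedes the point, so \<open>dir_deriv q v\<close> is again a function
  and can be differentiated further.\<close>

definition dir_deriv :: "('a::real_normed_vector \<Rightarrow> real) \<Rightarrow> 'a \<Rightarrow> 'a \<Rightarrow> real" where
  "dir_deriv q v x = frechet_derivative q (at x) v"

lemma dir_derivI:
  assumes "\<And>x. (q has_derivative q' x) (at x)"
  shows "dir_deriv q v = (\<lambda>x. q' x v)"
  by (rule ext) (simp add: dir_deriv_def flip: frechet_derivative_at [OF assms])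

lemma real_polynomial_function_has_derivative:
  "real_polynomial_function q \<Longrightarrow> (q has_derivative (\<lambda>v. dir_deriv q v x)) (at x)"
  unfolding dir_deriv_def
  using differentiable_at_real_polynomial_function frechet_derivative_works by fastforce

lemma dir_deriv_simps:
  "bounded_linear f \<Longrightarrow> dir_deriv f v = (\<lambda>x. f v)"
  "dir_deriv (\<lambda>x. c) v = (\<lambda>x. 0)"
  "\<lbrakk>real_polynomial_function f; real_polynomial_function g\<rbrakk> \<Longrightarrow>
     dir_deriv (\<lambda>x. f x + g x) v = (\<lambda>x. dir_deriv f v x + dir_deriv g v x)"
  "\<lbrakk>real_polynomial_function f; real_polynomial_function g\<rbrakk> \<Longrightarrow>
     dir_deriv (\<lambda>x. f x * g x) v = (\<lambda>x. f x * dir_deriv g v x + dir_deriv f v x * g x)"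
proof -
  show "bounded_linear f \<Longrightarrow> dir_deriv f v = (\<lambda>x. f v)"
    by (rule dir_derivI) (rule bounded_linear_imp_has_derivative)
  show "dir_deriv (\<lambda>x. c) v = (\<lambda>x. 0)"
    by (rule dir_derivI) (rule has_derivative_const)
  assume f: "real_polynomial_function f" and g: "real_polynomial_function g"
  show "dir_deriv (\<lambda>x. f x + g x) v = (\<lambda>x. dir_deriv f v x + dir_deriv g v x)"
    by (rule dir_derivI) (intro has_derivative_add real_polynomial_function_has_derivative f g)
  show "dir_deriv (\<lambda>x. f x * g x) v = (\<lambda>x. f x * dir_deriv g v x + dir_deriv f v x * g x)"
    by (rule dir_derivI) (intro has_derivative_mult real_polynomial_function_has_derivative f g)
qed

lemma real_polynomial_function_dir_deriv: "real_polynomial_function q \<Longrightarrow> real_polynomial_function (dir_deriv q v)"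
  by (induction q rule: real_polynomial_function.induct) (auto simp: dir_deriv_simps)

lemma dir_deriv_commute:
  "real_polynomial_function q \<Longrightarrow> dir_deriv (dir_deriv q u) v = dir_deriv (dir_deriv q v) u"
proof (induction q rule: real_polynomial_function.induct)
  case (mult f g)
  have *: "dir_deriv (dir_deriv (\<lambda>x. f x * g x) u) v = (\<lambda>x.
      (f x * dir_deriv (dir_deriv g u) v x + dir_deriv f v x * dir_deriv g u x) +
      (dir_deriv f u x * dir_deriv g v x + dir_deriv (dir_deriv f u) v x * g x))" for u v
    using mult(1,2) by (simp add: dir_deriv_simps real_polynomial_function.intros(4) real_polynomial_function_dir_deriv)
  show ?case unfolding * by (simp add: mult algebra_simps)
qed (auto simp: dir_deriv_simps real_polynomial_function_dir_deriv)

lemma real_polynomial_function_line_derivative: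
  assumes "real_polynomial_function q"
  shows "((\<lambda>t. q (x + t *\<^sub>R v)) has_real_derivative dir_deriv q v (x + t *\<^sub>R v)) (at t)"
proof -
  have "((\<lambda>t. x + t *\<^sub>R v) has_derivative (\<lambda>h. h *\<^sub>R v)) (at t)"
    by (auto intro!: derivative_eq_intros)
  from has_derivative_compose [OF this real_polynomial_function_has_derivative [OF assms]]
  have "((\<lambda>t. q (x + t *\<^sub>R v)) has_derivative (\<lambda>h. dir_deriv q (h *\<^sub>R v) (x + t *\<^sub>R v))) (at t)" .
  moreover have "dir_deriv q (h *\<^sub>R v) y = dir_deriv q v y * h" for h y
    using bounded_linear.linear [OF has_derivative_bounded_linear [OF real_polynomial_function_has_derivative [OF assms]]]
    by (metis linear_cmul mult.commute real_scaleR_def)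
  ultimately show ?thesis
    unfolding has_field_derivative_def by (simp only:)
qed

text \<open>\<open>deriv\<close> depends only on values near 0, so a formula \<open>F\<close> for
  the inner derivative on an open set suffices.\<close>

lemma Dk_step:
  assumes "open S" "x \<in> S" "\<And>y. y \<in> S \<Longrightarrow> Dk f y us = F y"
    and "((\<lambda>t. F (x + t *\<^sub>R u)) has_real_derivative D) (at 0)"
  shows "Dk f x (u # us) = D"
proof -
  have "open ((\<lambda>t. x + t *\<^sub>R u) -` S)"
    by (intro open_vimage assms continuous_intros)
  then have "((\<lambda>t. Dk f (x + t *\<^sub>R u) us) has_real_derivative D) (at 0)"
    using assms(2,3)
    by (intro has_field_derivative_transform_within_open [OF assms(4)]) auto
  then show ?thesis by (simp add: DERIV_imp_deriv)
qed

text \<open>The companion along a single line: a translation of the parameter moves the derivative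
  from 0 to \<open>t\<close>, so the step can be repeated in the same direction.\<close>

lemma Dk_line_step:
  assumes "open T" "t \<in> T" "\<And>t. t \<in> T \<Longrightarrow> Dk f (x + t *\<^sub>R u) us = h t"
    and "(h has_real_derivative D) (at t)"
  shows "Dk f (x + t *\<^sub>R u) (u # us) = D"
proof -
  have "((\<lambda>s. Dk f (x + s *\<^sub>R u) us) has_real_derivative D) (at (0 + t))"
    using has_field_derivative_transform_within_open [OF assms(4,1,2), of "\<lambda>s. Dk f (x + s *\<^sub>R u) us"]
      assms(3) by simp
  then have "((\<lambda>s. Dk f (x + (s + t) *\<^sub>R u) us) has_real_derivative D) (at 0)"
    unfolding DERIV_shift .
  then show ?thesis by (simp add: DERIV_imp_deriv algebra_simps)
qed

text \<open>Differentiating \<open>1 / (1 + t r)\<close> once and twice at 0 produces the first and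
  second moments of the weights. It is used with \<open>us = [u]\<close> for self-concordance and
  with \<open>us = [v]\<close> for the pairwise inequalities.\<close>

lemma Dk_line_partial_fractions:
  assumes "finite R" "open T" "0 \<in> T"
    and nz: "\<And>t j. t \<in> T \<Longrightarrow> j \<in> R \<Longrightarrow> 1 + t * r j \<noteq> 0"
    and Dk: "\<And>t. t \<in> T \<Longrightarrow> Dk f (x + t *\<^sub>R u) us = - (\<Sum>j\<in>R. m j / (1 + t * r j))"
  shows "Dk f x (u # us) = (\<Sum>j\<in>R. m j * r j)"
    and "Dk f x (u # u # us) = - 2 * (\<Sum>j\<in>R. m j * (r j)\<^sup>2)"
proof -
  have 1: "Dk f (x + t *\<^sub>R u) (u # us) = (\<Sum>j\<in>R. m j * r j / (1 + t * r j)\<^sup>2)" if "t \<in> T" for t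
    using assms(2) that Dk
  proof (rule Dk_line_step)
    have "((\<lambda>t. \<Sum>j\<in>R. m j / (1 + t * r j)) has_real_derivative
        (\<Sum>j\<in>R. - (m j * r j / (1 + t * r j)\<^sup>2))) (at t)"
      using nz [OF that]
      by (intro DERIV_sum) (auto intro!: derivative_eq_intros simp: power2_eq_square)
    from DERIV_minus [OF this]
    show "((\<lambda>t. - (\<Sum>j\<in>R. m j / (1 + t * r j))) has_real_derivative
        (\<Sum>j\<in>R. m j * r j / (1 + t * r j)\<^sup>2)) (at t)"
      by (simp add: sum_negf)
  qed
  from 1 [OF \<open>0 \<in> T\<close>] show "Dk f x (u # us) = (\<Sum>j\<in>R. m j * r j)" by simp
  have "Dk f (x + 0 *\<^sub>R u) (u # u # us) = (\<Sum>j\<in>R. - 2 * (m j * (r j)\<^sup>2))"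
    using assms(2,3) 1
  proof (rule Dk_line_step)
    show "((\<lambda>t. \<Sum>j\<in>R. m j * r j / (1 + t * r j)\<^sup>2) has_real_derivative
        (\<Sum>j\<in>R. - 2 * (m j * (r j)\<^sup>2))) (at 0)"
      by (intro DERIV_sum) (auto intro!: derivative_eq_intros simp: power2_eq_square)
  qed
  then show "Dk f x (u # u # us) = - 2 * (\<Sum>j\<in>R. m j * (r j)\<^sup>2)"
    by (simp add: sum_distrib_left)
qed

section \<open>Derivatives of \<open>- ln q\<close> for a positive polynomial function\<close>

context
  fixes q :: "'a::real_normed_vector \<Rightarrow> real" and S :: "'a set"
  assumes q: "real_polynomial_function q" and S: "open S" and pos: "\<And>x. x \<in> S \<Longrightarrow> q x > 0"
begin

lemma Dk_neg_ln_1: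
  assumes "x \<in> S"
  shows "Dk (\<lambda>x. - ln (q x)) x [u] = - (dir_deriv q u x / q x)"
proof (rule Dk_step [OF S assms])
  show "((\<lambda>t. - ln (q (x + t *\<^sub>R u))) has_real_derivative - (dir_deriv q u x / q x)) (at 0)"
    using real_polynomial_function_line_derivative [OF q, of x u 0] pos [OF assms]
    by (auto intro!: derivative_eq_intros)
qed simp

lemma Dk_neg_ln_2:
  assumes "x \<in> S"
  shows "Dk (\<lambda>x. - ln (q x)) x [v, u] =
    dir_deriv q u x * dir_deriv q v x / (q x)\<^sup>2 - dir_deriv (dir_deriv q u) v x / q x"
proof (rule Dk_step [OF S assms Dk_neg_ln_1])
  show "((\<lambda>t. - (dir_deriv q u (x + t *\<^sub>R v) / q (x + t *\<^sub>R v))) has_real_derivative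
      dir_deriv q u x * dir_deriv q v x / (q x)\<^sup>2 - dir_deriv (dir_deriv q u) v x / q x) (at 0)"
    using real_polynomial_function_line_derivative [OF q, of x v 0] pos [OF assms]
      real_polynomial_function_line_derivative [OF real_polynomial_function_dir_deriv [OF q], of u x v 0]
    by (auto intro!: derivative_eq_intros simp: divide_simps power2_eq_square)
qed

lemma Dk_neg_ln_3:
  assumes "x \<in> S"
  shows "Dk (\<lambda>x. - ln (q x)) x [w, v, u] =
      - dir_deriv (dir_deriv (dir_deriv q u) v) w x / q x
      + (dir_deriv (dir_deriv q u) v x * dir_deriv q w x
         + dir_deriv (dir_deriv q u) w x * dir_deriv q v x
         + dir_deriv q u x * dir_deriv (dir_deriv q v) w x) / (q x)\<^sup>2
      - 2 * dir_deriv q u x * dir_deriv q v x * dir_deriv q w x / (q x) ^ 3"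
    (is "_ = ?D")
proof (rule Dk_step [OF S assms Dk_neg_ln_2])
  show "((\<lambda>t. dir_deriv q u (x + t *\<^sub>R w) * dir_deriv q v (x + t *\<^sub>R w) / (q (x + t *\<^sub>R w))\<^sup>2
        - dir_deriv (dir_deriv q u) v (x + t *\<^sub>R w) / q (x + t *\<^sub>R w)) has_real_derivative ?D) (at 0)"
    using real_polynomial_function_line_derivative [OF q, of x w 0] pos [OF assms]
      real_polynomial_function_line_derivative [OF real_polynomial_function_dir_deriv [OF q], of u x w 0]
      real_polynomial_function_line_derivative [OF real_polynomial_function_dir_deriv [OF q], of v x w 0]
      real_polynomial_function_line_derivative [OF real_polynomial_function_dir_deriv
        [OF real_polynomial_function_dir_deriv [OF q]], of u v x w 0]
    by (auto intro!: derivative_eq_intros simp: field_simps power2_eq_square power3_eq_cube power4_eq_xxxx)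
qed

lemma Dk_neg_ln_2_commute:
  assumes "x \<in> S"
  shows "Dk (\<lambda>x. - ln (q x)) x [v, u] = Dk (\<lambda>x. - ln (q x)) x [u, v]"
  unfolding Dk_neg_ln_2 [OF assms] dir_deriv_commute [OF q, of u v] by (simp only: mult.commute)

text \<open>Moves \<open>v\<close> to the innermost position, as required when the remaining
  derivatives are taken along one line in direction \<open>u\<close>.\<close>

lemma Dk_neg_ln_3_commute:
  assumes "x \<in> S"
  shows "Dk (\<lambda>x. - ln (q x)) x [v, u, u] = Dk (\<lambda>x. - ln (q x)) x [u, u, v]"
proof -
  have "dir_deriv (dir_deriv (dir_deriv q u) u) v = dir_deriv (dir_deriv (dir_deriv q v) u) u"
    by (simp only: dir_deriv_commute [OF real_polynomial_function_dir_deriv [OF q], of u u v]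
        dir_deriv_commute [OF q, of u v])
  then show ?thesis
    unfolding Dk_neg_ln_3 [OF assms] dir_deriv_commute [OF q, of u v] by (simp add: mult_ac)
qed

end

section \<open>Continuous differentiability of rational functions and of
  \<open>- ln q\<close>\<close>

lemma cont_diff_on_cong:
  assumes "open S" "\<And>x. x \<in> S \<Longrightarrow> f x = g x" "cont_diff_on k f S"
  shows "cont_diff_on k g S"
  using assms(2,3)
proof (induction k arbitrary: f g)
  case 0
  then show ?case using continuous_on_cong by force
next
  case (Suc k)
  have diff: "f differentiable at x" if "x \<in> S" for x using Suc.prems that by simp
  have "g differentiable at x" if "x \<in> S" for x
    using diff [OF that] Suc.prems(1) assms(1) that
    by (meson differentiable_def has_derivative_transform_within_open)
  moreover have "cont_diff_on k (\<lambda>x. frechet_derivative g (at x) v) S" for v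
  proof (rule Suc.IH)
    show "cont_diff_on k (\<lambda>x. frechet_derivative f (at x) v) S" using Suc.prems by simp
    show "frechet_derivative f (at x) v = frechet_derivative g (at x) v" if "x \<in> S" for x
      using frechet_derivative_transform_within_open [OF diff [OF that] assms(1) that] Suc.prems(1)
      by metis
  qed
  ultimately show ?case by simp
qed

lemma cont_diff_on_SucI:
  assumes "open S" "\<And>x. x \<in> S \<Longrightarrow> (f has_derivative f' x) (at x)"
    and "\<And>v. cont_diff_on k (\<lambda>x. f' x v) S"
  shows "cont_diff_on (Suc k) f S"
proof -
  have "cont_diff_on k (\<lambda>x. frechet_derivative f (at x) v) S" for v
    by (rule cont_diff_on_cong [OF assms(1) _ assms(3)]) (simp flip: frechet_derivative_at [OF assms(2)])
  then show ?thesis using differentiableI [OF assms(2)] by simp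
qed

text \<open>Quotients with a power of the fixed \<open>q\<close> as denominator are closed under
  directional derivatives: the quotient rule replaces \<open>q ^ m\<close> by
  \<open>q ^ (2 * m)\<close>. Hence the induction generalizes over numerator and exponent.\<close>

lemma cont_diff_on_rational:
  fixes q :: "'a::euclidean_space \<Rightarrow> real"
  assumes q: "real_polynomial_function q" and S: "open S" and nz: "\<And>x. x \<in> S \<Longrightarrow> q x \<noteq> 0"
    and "real_polynomial_function r"
  shows "cont_diff_on k (\<lambda>x. r x / q x ^ m) S"
  using assms(4)
proof (induction k arbitrary: r m)
  case 0
  have "continuous_on S r" "continuous_on S q"
    using 0 q by (meson continuous_on_polymonial_function continuous_on_subset real_polynomial_function_eq top_greatest)+
  then show ?case using nz by (auto intro!: continuous_intros)
next
  case (Suc k)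
  \<comment> \<open>For \<open>m = 0\<close> the truncated exponent is harmless because the factor
    \<open>m\<close> vanishes.\<close>
  define r' where "r' v x = dir_deriv r v x * q x ^ m - r x * (m * dir_deriv q v x * q x ^ (m - 1))" for v x
  show ?case
  proof (rule cont_diff_on_SucI [OF S])
    show "((\<lambda>x. r x / q x ^ m) has_derivative (\<lambda>v. r' v x / q x ^ (2 * m))) (at x)" if "x \<in> S" for x
    proof -
      have "((\<lambda>x. q x ^ m) has_derivative (\<lambda>v. m * dir_deriv q v x * q x ^ (m - 1))) (at x)"
        by (intro has_derivative_power real_polynomial_function_has_derivative q)
      from has_derivative_divide' [OF real_polynomial_function_has_derivative [OF Suc.prems] this]
      show ?thesis using nz [OF that] by (simp add: r'_def power_add [symmetric] mult_2)
    qed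
    fix v
    have "real_polynomial_function (r' v)"
      unfolding r'_def
      by (intro real_polynomial_function_diff real_polynomial_function_power
          real_polynomial_function.intros(2,4) real_polynomial_function_dir_deriv q Suc.prems)
    then show "cont_diff_on k (\<lambda>x. r' v x / q x ^ (2 * m)) S" by (rule Suc.IH)
  qed
qed

lemma cont_diff_on_neg_ln:
  fixes q :: "'a::euclidean_space \<Rightarrow> real"
  assumes q: "real_polynomial_function q" and S: "open S" and pos: "\<And>x. x \<in> S \<Longrightarrow> q x > 0"
  shows "cont_diff_on (Suc k) (\<lambda>x. - ln (q x)) S"
proof (rule cont_diff_on_SucI [OF S])
  show "((\<lambda>x. - ln (q x)) has_derivative (\<lambda>v. - dir_deriv q v x / q x ^ 1)) (at x)" if "x \<in> S" for x
    using pos [OF that] real_polynomial_function_has_derivative [OF q, of x]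
    by (auto intro!: derivative_eq_intros simp: divide_inverse)
  fix v
  have "real_polynomial_function (\<lambda>x. - dir_deriv q v x)"
    using real_polynomial_function_dir_deriv [OF q] by blast
  then show "cont_diff_on k (\<lambda>x. - dir_deriv q v x / q x ^ 1) S"
    by (intro cont_diff_on_rational q S) (use pos in force)
qed

lemma real_polynomial_function_mp_eval: "real_polynomial_function (mp_eval p)"
proof -
  have "real_polynomial_function (\<lambda>x. mp_eval p x)"
    unfolding mp_eval_def mp_subst_def
    by (intro real_polynomial_function_sum real_polynomial_function_prod real_polynomial_function_power
        real_polynomial_function.intros(2,4) real_polynomial_function.intros(1) [OF bounded_linear_vec_nth]) auto
  then show ?thesis .
qed

section \<open>The logarithmic barrier\<close>

text \<open>Each entry is bounded by the Euclidean norm \<open>N\<close>, so the cubes sum to at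
  most \<open>N\<close> times the sum of squares, which is \<open>N ^ 3\<close>.\<close>

lemma sum_abs_cube_le:
  fixes l :: "nat \<Rightarrow> real"
  shows "\<bar>\<Sum>j<n. l j ^ 3\<bar> \<le> (\<Sum>j<n. (l j)\<^sup>2) powr (3 / 2)"
proof -
  define N where "N = sqrt (\<Sum>j<n. (l j)\<^sup>2)"
  have N: "N \<ge> 0" "N\<^sup>2 = (\<Sum>j<n. (l j)\<^sup>2)" by (simp_all add: N_def sum_nonneg)
  have "\<bar>l j\<bar> \<le> N" if "j < n" for j
  proof -
    have "(l j)\<^sup>2 \<le> (\<Sum>j<n. (l j)\<^sup>2)" using that by (intro member_le_sum) auto
    then show ?thesis unfolding N_def by (intro real_le_rsqrt) simp
  qed
  then have "\<bar>l j ^ 3\<bar> \<le> N * (l j)\<^sup>2" if "j < n" for j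
    using that mult_right_mono [of "\<bar>l j\<bar>" N "(l j)\<^sup>2"]
    by (simp add: power_abs power2_eq_square power3_eq_cube abs_mult mult.assoc)
  then have "\<bar>\<Sum>j<n. l j ^ 3\<bar> \<le> (\<Sum>j<n. N * (l j)\<^sup>2)"
    by (intro order.trans [OF sum_abs] sum_mono) auto
  also have "\<dots> = N ^ 3"
    unfolding sum_distrib_left [symmetric] N(2) [symmetric] by (simp add: eval_nat_numeral)
  also have "\<dots> = (N\<^sup>2) powr (3 / 2)"
  proof (cases "N = 0")
    case False
    then have "N > 0" using N(1) by simp
    then have "(N\<^sup>2) powr (3 / 2) = N powr 3"
      by (simp add: powr_powr flip: powr_numeral)
    then show ?thesis using \<open>N > 0\<close> by (simp flip: powr_numeral)
  qed simp
  finally show ?thesis by (simp add: N(2))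
qed

declare Dk.simps [simp del]

context hyperbolic_poly
begin

text \<open>The sorted list of real roots has exactly \<open>d\<close> entries because the line
  polynomial is real-rooted of degree \<open>d\<close>. The indices therefore reach every root and
  never run off the list, and nonnegative roots amount to
  \<open>closure_pos_cone_iff\<close>.\<close>

lemma hyp_cone_eq: "hyp_cone d p e = closure pos_cone"
proof (rule set_eqI)
  fix x
  define f where "f = line_poly p e x"
  define L where "L = rev (sorted_list_of_multiset (proots f))"
  have deg: "degree f = d" and lc: "lead_coeff f = mp_eval p e"
    unfolding f_def by (rule line_poly_degree_eq [OF e_in_pos_cone])+
  then have "f \<noteq> 0" using eval_e_pos by auto
  have "size (proots f) = d"
    using size_proots_real_rooted [OF \<open>f \<noteq> 0\<close>] real_rooted_line_poly [OF e_in_pos_cone, of x] deg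
    by (simp add: f_def)
  moreover have "size (proots f) = length L"
    unfolding L_def by (metis length_rev mset_sorted_list_of_multiset size_mset)
  ultimately have len: "length L = d" by simp
  have set: "set L = {t. poly f t = 0}"
    using \<open>f \<noteq> 0\<close> by (simp add: L_def)
  have "x \<in> hyp_cone d p e \<longleftrightarrow> (\<forall>i\<in>{1..d}. L ! (i - 1) \<ge> 0)"
    by (simp add: hyp_cone_def hyp_eigenvalue_def L_def f_def)
  also have "\<dots> \<longleftrightarrow> (\<forall>i<d. L ! i \<ge> 0)"
  proof (intro iffI allI impI ballI)
    fix i assume "\<forall>i\<in>{1..d}. L ! (i - 1) \<ge> 0" "i < d"
    then show "L ! i \<ge> 0" by (auto dest: bspec [of _ _ "Suc i"])
  qed auto
  also have "\<dots> \<longleftrightarrow> (\<forall>t\<in>set L. t \<ge> 0)"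
    by (simp add: all_set_conv_all_nth len)
  also have "\<dots> \<longleftrightarrow> (\<forall>s>0. mp_eval p (x + s *\<^sub>R e) \<noteq> 0)"
  proof -
    have ev: "poly f (- s) = (- 1) ^ d * mp_eval p (x + s *\<^sub>R e)" for s
    proof -
      have "(- s) *\<^sub>R e - x = (- 1) *\<^sub>R (x + s *\<^sub>R e)" by simp
      then show ?thesis by (simp only: f_def poly_line_poly mp_eval_scaleR [OF hom])
    qed
    have "(\<forall>t\<in>set L. t \<ge> 0) \<longleftrightarrow> (\<forall>s>0. poly f (- s) \<noteq> 0)"
    proof (intro iffI ballI allI impI)
      fix s :: real assume "\<forall>t\<in>set L. t \<ge> 0" "s > 0"
      then show "poly f (- s) \<noteq> 0" by (auto simp: set)
    next
      fix t assume "\<forall>s>0. poly f (- s) \<noteq> 0" "t \<in> set L"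
      then show "t \<ge> 0" by (cases "t \<ge> 0") (auto simp: set dest: spec [of _ "- t"])
    qed
    then show ?thesis by (simp add: ev)
  qed
  also have "\<dots> \<longleftrightarrow> (\<forall>s>0. x + s *\<^sub>R e \<in> pos_cone)"
  proof (intro iffI allI impI)
    fix s :: real assume *: "\<forall>s>0. mp_eval p (x + s *\<^sub>R e) \<noteq> 0" and "s > 0"
    then show "x + s *\<^sub>R e \<in> pos_cone"
      by (simp add: pos_cone_def add.assoc flip: scaleR_add_left)
  next
    fix s :: real assume "\<forall>s>0. x + s *\<^sub>R e \<in> pos_cone" "s > 0"
    then show "mp_eval p (x + s *\<^sub>R e) \<noteq> 0" using eval_pos by force
  qed
  finally show "x \<in> hyp_cone d p e \<longleftrightarrow> x \<in> closure pos_cone"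
    by (simp add: closure_pos_cone_iff)
qed

text \<open>For \<open>t \<noteq> 0\<close> homogeneity gives
  \<open>p (x + t u) = (- t) ^ d * f (- 1 / t)\<close> with \<open>f\<close> the line polynomial in
  direction \<open>x\<close>. The \<open>l j\<close> are its roots, the eigenvalues of
  \<open>u\<close> relative to \<open>x\<close>.\<close>

lemma eval_line_factorization:
  assumes "x \<in> pos_cone"
  obtains l :: "nat \<Rightarrow> real" where
    "\<And>t. mp_eval p (x + t *\<^sub>R u) = mp_eval p x * (\<Prod>j<d. 1 + t * l j)"
proof -
  define f where "f = line_poly p x u"
  have deg: "degree f = d" and lc: "lead_coeff f = mp_eval p x"
    unfolding f_def by (rule line_poly_degree_eq [OF assms])+
  obtain l :: "nat \<Rightarrow> real" where l: "f = smult (mp_eval p x) (\<Prod>j<d. [:- l j, 1:])"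
    using real_rooted_factorization [of f] real_rooted_line_poly [OF assms] lc deg
    by (metis f_def)
  have f: "poly f t = mp_eval p x * (\<Prod>j<d. t - l j)" for t
    by (subst l) (simp add: poly_prod)
  have "mp_eval p (x + t *\<^sub>R u) = mp_eval p x * (\<Prod>j<d. 1 + t * l j)" for t
  proof (cases "t = 0")
    case False
    have "x + t *\<^sub>R u = (- t) *\<^sub>R ((- 1 / t) *\<^sub>R x - u)"
      using False by (simp add: algebra_simps)
    then have "mp_eval p (x + t *\<^sub>R u) = (- t) ^ d * poly f (- 1 / t)"
      by (simp only: mp_eval_scaleR [OF hom] f_def poly_line_poly)
    also have "\<dots> = mp_eval p x * ((\<Prod>j<d. - t) * (\<Prod>j<d. - 1 / t - l j))"
      by (simp add: f)
    also have "\<dots> = mp_eval p x * (\<Prod>j<d. 1 + t * l j)"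
    proof -
      have "- t * (- 1 / t - l j) = 1 + t * l j" for j using False by (simp add: field_simps)
      then show ?thesis by (simp only: prod.distrib [symmetric])
    qed
    finally show ?thesis .
  qed simp
  then show ?thesis using that by blast
qed

abbreviation barrier :: "real ^ 'n \<Rightarrow> real" where
  "barrier \<equiv> \<lambda>x. - ln (mp_eval p x)"

text \<open>Along the line the barrier is a constant minus the sum of
  \<open>ln (1 + t * l j)\<close>. Its second and third derivatives at 0 are the sum of squares and
  minus twice the sum of cubes, which \<open>sum_abs_cube_le\<close> compares.\<close>

lemma barrier_self_concordance:
  assumes x: "x \<in> pos_cone"
  shows "\<bar>Dk barrier x [u, u, u]\<bar> \<le> 2 * Dk barrier x [u, u] powr (3 / 2)"
proof -
  obtain l :: "nat \<Rightarrow> real" where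
    l: "\<And>t. mp_eval p (x + t *\<^sub>R u) = mp_eval p x * (\<Prod>j<d. 1 + t * l j)"
    using eval_line_factorization [OF x, of u] by blast
  define T where "T = {t. x + t *\<^sub>R u \<in> pos_cone}"
  have T: "open T" "0 \<in> T" using open_pos_cone_line x by (simp_all add: T_def)
  have h: "mp_eval p x * (\<Prod>j<d. 1 + t * l j) > 0" if "t \<in> T" for t
    using eval_pos [of "x + t *\<^sub>R u"] that by (simp add: T_def l)
  have nz: "1 + t * l j \<noteq> 0" if "t \<in> T" "j \<in> {..<d}" for t j
    using h [OF that(1)] that(2) prod_zero [of "{..<d}" "\<lambda>j. 1 + t * l j"]
    by (metis finite_lessThan less_irrefl mult_zero_right)
  have "Dk barrier (x + t *\<^sub>R u) [u] = - (\<Sum>j<d. l j / (1 + t * l j))" if "t \<in> T" for t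
  proof -
    have "((\<lambda>t. \<Prod>j<d. 1 + t * l j) has_real_derivative
        (\<Sum>j<d. l j * (\<Prod>i\<in>{..<d} - {j}. 1 + t * l i))) (at t)"
      by (rule has_field_derivative_prod) (auto intro!: derivative_eq_intros)
    moreover have "(\<Sum>j<d. l j * (\<Prod>i\<in>{..<d} - {j}. 1 + t * l i)) =
        (\<Prod>j<d. 1 + t * l j) * (\<Sum>j<d. l j / (1 + t * l j))"
      unfolding sum_distrib_left
    proof (rule sum.cong)
      fix j assume j: "j \<in> {..<d}"
      then have "(\<Prod>j<d. 1 + t * l j) = (1 + t * l j) * (\<Prod>i\<in>{..<d} - {j}. 1 + t * l i)"
        by (simp add: prod.remove)
      then show "l j * (\<Prod>i\<in>{..<d} - {j}. 1 + t * l i) = (\<Prod>j<d. 1 + t * l j) * (l j / (1 + t * l j))"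
        using nz [OF that j] by simp
    qed simp
    ultimately have D: "((\<lambda>t. mp_eval p (x + t *\<^sub>R u)) has_real_derivative
        mp_eval p x * ((\<Prod>j<d. 1 + t * l j) * (\<Sum>j<d. l j / (1 + t * l j)))) (at t)"
      unfolding l by (intro DERIV_cmult) simp
    have "((\<lambda>t. barrier (x + t *\<^sub>R u)) has_real_derivative
        - (\<Sum>j<d. l j / (1 + t * l j))) (at t)"
    proof -
      have "mp_eval p x \<noteq> 0" "(\<Prod>j<d. 1 + t * l j) \<noteq> 0"
        using h [OF that] by (metis less_irrefl mult_zero_left, metis less_irrefl mult_zero_right)
      then have "inverse (mp_eval p (x + t *\<^sub>R u)) *
          (mp_eval p x * ((\<Prod>j<d. 1 + t * l j) * (\<Sum>j<d. l j / (1 + t * l j)))) =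
          (\<Sum>j<d. l j / (1 + t * l j))"
        unfolding l by (simp add: field_simps)
      moreover have "mp_eval p (x + t *\<^sub>R u) > 0" using h [OF that] by (simp add: l)
      ultimately show ?thesis using DERIV_minus [OF DERIV_chain2 [OF DERIV_ln D]] by (simp only:)
    qed
    then show ?thesis
      by (intro Dk_line_step [OF T(1) that, where h = "\<lambda>t. barrier (x + t *\<^sub>R u)"])
        (simp add: Dk.simps)
  qed
  note D = Dk_line_partial_fractions [OF finite_lessThan T nz this]
  have "Dk barrier x [u, u] = (\<Sum>j<d. (l j)\<^sup>2)"
    using D(1) by (simp add: power2_eq_square)
  moreover have "Dk barrier x [u, u, u] = - 2 * (\<Sum>j<d. l j ^ 3)"
    using D(2) by (simp add: power2_eq_square power3_eq_cube mult.assoc)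
  ultimately show ?thesis using sum_abs_cube_le [of l d] by (simp add: abs_mult)
qed

text \<open>With \<open>z\<close> fixed, the argument of \<open>p\<close> as a function of
  \<open>s\<close> has imaginary part \<open>Im z\<close> times \<open>x\<close> plus
  \<open>Im s\<close> times \<open>v\<close>, a point of the open cone when
  \<open>Im s \<ge> 0\<close>. So \<open>Im_coeff_ratio_nonpos\<close> applies in
  \<open>s\<close>.\<close>

lemma Im_ratio_nonpos:
  assumes x: "x \<in> pos_cone" and v: "v \<in> closure pos_cone" and z: "Im z > 0"
  shows "Im (poly (cpoly (coeff (line_poly2 p x u v) 1)) z /
    poly (cpoly (line_poly p x u)) z) \<le> 0"
proof -
  have "poly (line_poly2_at p x u v z) s \<noteq> 0" if "Im s \<ge> 0" for s
  proof -
    have "z *s cvec x - cvec u + s *s cvec v =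
        cvec (Re z *\<^sub>R x - u + Re s *\<^sub>R v) + \<i> *s cvec (Im z *\<^sub>R x + Im s *\<^sub>R v)"
      by (simp add: vec_eq_iff complex_eq_iff)
    moreover have "Im z *\<^sub>R x + Im s *\<^sub>R v \<in> pos_cone"
      by (intro closure_add_pos_cone closure_pos_cone_scaleR pos_cone_scaleR x v z that)
    ultimately show ?thesis
      using ceval_nonzero by (simp only: poly_line_poly2_at) simp
  qed
  from Im_coeff_ratio_nonpos [OF this] show ?thesis
    by (simp only: coeff_line_poly2_at coeff_0_line_poly2)
qed

text \<open>The linear coefficient in \<open>s\<close> is the derivative at
  \<open>s = 0\<close>.\<close>

lemma dir_deriv_eval_line:
  "dir_deriv (mp_eval p) v (t *\<^sub>R x - u) = poly (coeff (line_poly2 p x u v) 1) t"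
proof -
  define b where "b = map_poly (\<lambda>b. poly b t) (line_poly2 p x u v)"
  have "poly (poly B [:s:]) t = poly (map_poly (\<lambda>b. poly b t) B) s" for B and s :: real
    by (induction B) (simp_all add: map_poly_pCons)
  then have b: "poly b s = mp_eval p ((t *\<^sub>R x - u) + s *\<^sub>R v)" for s
    by (simp add: b_def flip: poly_line_poly2)
  have "((\<lambda>s. mp_eval p ((t *\<^sub>R x - u) + s *\<^sub>R v)) has_real_derivative
      dir_deriv (mp_eval p) v ((t *\<^sub>R x - u) + 0 *\<^sub>R v)) (at 0)"
    by (rule real_polynomial_function_line_derivative [OF real_polynomial_function_mp_eval])
  moreover have "((\<lambda>s. mp_eval p ((t *\<^sub>R x - u) + s *\<^sub>R v)) has_real_derivative poly (pderiv b) 0) (at 0)"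
    unfolding b [symmetric] by (rule poly_DERIV)
  ultimately have "dir_deriv (mp_eval p) v ((t *\<^sub>R x - u) + 0 *\<^sub>R v) = poly (pderiv b) 0"
    by (rule DERIV_unique)
  then show ?thesis by (simp add: poly_0_coeff_0 coeff_pderiv b_def coeff_map_poly)
qed

text \<open>First derivatives of \<open>p\<close> are homogeneous of degree one less;
  \<open>c ^ d / c\<close> avoids subtraction on natural numbers.\<close>

lemma dir_deriv_eval_scaleR:
  assumes "c \<noteq> 0"
  shows "dir_deriv (mp_eval p) v (c *\<^sub>R y) = c ^ d / c * dir_deriv (mp_eval p) v y"
proof -
  have "((\<lambda>s. mp_eval p (c *\<^sub>R y + s *\<^sub>R v)) has_real_derivative
      dir_deriv (mp_eval p) v (c *\<^sub>R y + 0 *\<^sub>R v)) (at 0)"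
    by (rule real_polynomial_function_line_derivative [OF real_polynomial_function_mp_eval])
  moreover have "((\<lambda>s. mp_eval p (c *\<^sub>R y + s *\<^sub>R v)) has_real_derivative
      c ^ d / c * dir_deriv (mp_eval p) v y) (at 0)"
  proof -
    have "((\<lambda>s. mp_eval p (y + s *\<^sub>R v)) has_real_derivative dir_deriv (mp_eval p) v y) (at (0 / c))"
      using real_polynomial_function_line_derivative [OF real_polynomial_function_mp_eval, of p y v 0] by simp
    then have "((\<lambda>s. c ^ d * mp_eval p (y + (s / c) *\<^sub>R v)) has_real_derivative
      c ^ d * (dir_deriv (mp_eval p) v y * (1 / c))) (at 0)"
      by (intro DERIV_cmult DERIV_chain2 [where g = "\<lambda>s. s / c"]) (use assms in \<open>auto intro!: derivative_eq_intros\<close>)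
    moreover have "c ^ d * mp_eval p (y + (s / c) *\<^sub>R v) = mp_eval p (c *\<^sub>R y + s *\<^sub>R v)" for s
      using assms by (simp add: scaleR_add_right flip: mp_eval_scaleR [OF hom])
    ultimately show ?thesis by simp
  qed
  ultimately show ?thesis using DERIV_unique by force
qed

text \<open>The weights are the residues of the logarithmic derivative along \<open>v\<close> at
  \<open>t x - u\<close>, and the nodes are poles among the eigenvalues of \<open>u\<close> relative
  to \<open>x\<close>. Passing from \<open>t\<close> to \<open>- 1 / t\<close> yields the form
  needed by \<open>Dk_line_partial_fractions\<close>.\<close>

lemma barrier_pairwise_moments:
  assumes x: "x \<in> pos_cone" and u: "u \<in> closure pos_cone" and v: "v \<in> closure pos_cone"
    and c: "c *\<^sub>R x - u \<in> closure pos_cone"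
  shows "\<exists>R m. finite R \<and> (\<forall>r\<in>R. 0 \<le> r \<and> r \<le> c \<and> m r \<ge> 0) \<and>
    Dk barrier x [v, u] = (\<Sum>r\<in>R. m r * r) \<and>
    Dk barrier x [v, u, u] = - 2 * (\<Sum>r\<in>R. m r * r\<^sup>2)"
proof -
  define f where "f = line_poly p x u"
  define g where "g = coeff (line_poly2 p x u v) 1"
  have deg: "degree f = d" and "lead_coeff f = mp_eval p x"
    unfolding f_def by (rule line_poly_degree_eq [OF x])+
  then have "f \<noteq> 0" using eval_pos [OF x] by auto
  moreover have "degree g < degree f \<or> g = 0"
    using total_degree_line_poly2 [OF hom, of x u v] deg unfolding total_degree_le_def g_def by force
  moreover have "\<And>z. poly (cpoly f) z = 0 \<Longrightarrow> z \<in> \<real>"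
    unfolding f_def by (rule real_rooted_line_poly [OF x])
  moreover have "\<And>z. Im z > 0 \<Longrightarrow> Im (poly (cpoly g) z / poly (cpoly f) z) \<le> 0"
    unfolding f_def g_def by (rule Im_ratio_nonpos [OF x v])
  ultimately have "\<exists>R m. finite R \<and> (\<forall>r\<in>R. poly f r = 0 \<and> m r \<ge> 0) \<and>
      (\<forall>t. poly f t \<noteq> 0 \<longrightarrow> poly g t / poly f t = (\<Sum>r\<in>R. m r / (t - r)))"
    by (rule nevanlinna_partial_fractions)
  then obtain R m where R: "finite R" "\<And>r. r \<in> R \<Longrightarrow> poly f r = 0"
    "\<And>r. r \<in> R \<Longrightarrow> m r \<ge> 0"
    "\<And>t. poly f t \<noteq> 0 \<Longrightarrow> poly g t / poly f t = (\<Sum>r\<in>R. m r / (t - r))"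
    by blast
  \<comment> \<open>A root \<open>r < 0\<close> would put \<open>u - r x\<close> into the open cone,
    and a root \<open>r > c\<close> would put \<open>r x - u\<close> there; \<open>p\<close> is
    positive on that cone.\<close>
  have bounds: "0 \<le> r \<and> r \<le> c" if "r \<in> R" for r
  proof -
    have 0: "mp_eval p (r *\<^sub>R x - u) = 0" using R(2) [OF that] by (simp add: f_def poly_line_poly)
    have "r \<ge> 0"
    proof (rule ccontr)
      assume "\<not> r \<ge> 0"
      then have "(- r) *\<^sub>R x + u \<in> pos_cone"
        by (intro closure_add_pos_cone pos_cone_scaleR x u) auto
      then have "mp_eval p ((- r) *\<^sub>R x + u) > 0" by (rule eval_pos)
      moreover have "(- r) *\<^sub>R x + u = (- 1) *\<^sub>R (r *\<^sub>R x - u)" by simp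
      ultimately show False using 0 by (simp only: mp_eval_scaleR [OF hom])
    qed
    moreover have "r \<le> c"
    proof (rule ccontr)
      assume "\<not> r \<le> c"
      then have "(r - c) *\<^sub>R x + (c *\<^sub>R x - u) \<in> pos_cone"
        by (intro closure_add_pos_cone pos_cone_scaleR x c) auto
      then have "mp_eval p ((r - c) *\<^sub>R x + (c *\<^sub>R x - u)) > 0" by (rule eval_pos)
      then show False using 0 by (simp add: algebra_simps)
    qed
    ultimately show ?thesis by simp
  qed
  define T where "T = {t. x + t *\<^sub>R u \<in> pos_cone}"
  have T: "open T" "0 \<in> T" using open_pos_cone_line x by (simp_all add: T_def)
  have flip: "x + t *\<^sub>R u = (- t) *\<^sub>R ((- 1 / t) *\<^sub>R x - u)" if "t \<noteq> 0" for t
    using that by (simp add: algebra_simps)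
  have f_nz: "poly f (- 1 / t) \<noteq> 0" if "t \<in> T" "t \<noteq> 0" for t
  proof
    assume "poly f (- 1 / t) = 0"
    then have "mp_eval p (x + t *\<^sub>R u) = 0"
      unfolding flip [OF that(2)] mp_eval_scaleR [OF hom] by (simp add: f_def poly_line_poly)
    then show False using eval_pos [of "x + t *\<^sub>R u"] that by (simp add: T_def)
  qed
  have nz: "1 + t * r \<noteq> 0" if "t \<in> T" "r \<in> R" for t r
  proof
    assume *: "1 + t * r = 0"
    then have "t \<noteq> 0" by auto
    then have "r = - 1 / t" using * by (simp add: field_simps)
    then show False using f_nz [OF that(1) \<open>t \<noteq> 0\<close>] R(2) [OF that(2)] by simp
  qed
  define G where "G t = dir_deriv (mp_eval p) v (x + t *\<^sub>R u) / mp_eval p (x + t *\<^sub>R u)" for t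
  define H where "H t = (\<Sum>r\<in>R. m r / (1 + t * r))" for t
  have GH: "G t = H t" if "t \<in> T" "t \<noteq> 0" for t
  proof -
    let ?t = "- 1 / t"
    have "- t \<noteq> 0" using \<open>t \<noteq> 0\<close> by simp
    then have "G t = ((- t) ^ d / (- t) * poly g ?t) / ((- t) ^ d * poly f ?t)"
      by (simp only: G_def flip [OF \<open>t \<noteq> 0\<close>] mp_eval_scaleR [OF hom] dir_deriv_eval_scaleR
          dir_deriv_eval_line g_def f_def poly_line_poly not_False_eq_True)
    also have "\<dots> = ?t * (poly g ?t / poly f ?t)"
      using \<open>t \<noteq> 0\<close> by simp
    also have "\<dots> = (\<Sum>r\<in>R. ?t * (m r / (?t - r)))"
      by (simp only: R(4) [OF f_nz [OF that]] sum_distrib_left)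
    also have "\<dots> = H t"
      unfolding H_def
    proof (rule sum.cong)
      fix r assume "r \<in> R"
      have "?t - r = ?t * (1 + t * r)" using \<open>t \<noteq> 0\<close> by (simp add: field_simps)
      then show "?t * (m r / (?t - r)) = m r / (1 + t * r)" using \<open>t \<noteq> 0\<close> by simp
    qed simp
    finally show ?thesis .
  qed
  \<comment> \<open>The inversion \<open>- 1 / t\<close> says nothing at \<open>t = 0\<close>;
    continuity of both sides closes the gap.\<close>
  have "G 0 = H 0"
  proof (rule tendsto_unique [OF trivial_limit_at])
    have cont: "isCont (\<lambda>t. q (x + t *\<^sub>R u)) 0" if "real_polynomial_function q" for q
      using DERIV_isCont [OF real_polynomial_function_line_derivative [OF that]] .
    have "isCont G 0"
      unfolding G_def using eval_pos [OF x]
      by (intro isCont_divide cont real_polynomial_function_dir_deriv real_polynomial_function_mp_eval) auto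
    then show "(G \<longlongrightarrow> G 0) (at 0)" by (simp add: isCont_def)
    have "isCont H 0" unfolding H_def by (intro continuous_intros) auto
    then have "(H \<longlongrightarrow> H 0) (at 0)" by (simp add: isCont_def)
    moreover have "\<forall>\<^sub>F t in at 0. H t = G t"
      using T GH by (auto simp: eventually_at_topological)
    ultimately show "(G \<longlongrightarrow> H 0) (at 0)" by (rule Lim_transform_eventually)
  qed
  then have "Dk barrier (x + t *\<^sub>R u) [v] = - (\<Sum>r\<in>R. m r / (1 + t * r))" if "t \<in> T" for t
    using GH [OF that] that Dk_neg_ln_1 [OF real_polynomial_function_mp_eval open_pos_cone eval_pos, of "x + t *\<^sub>R u" v]
    by (cases "t = 0") (auto simp: G_def H_def T_def)
  note D = Dk_line_partial_fractions [OF R(1) T nz this]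
  have "Dk barrier x [v, u] = (\<Sum>r\<in>R. m r * r)"
    using D(1) Dk_neg_ln_2_commute [OF real_polynomial_function_mp_eval open_pos_cone eval_pos x] by simp
  moreover have "Dk barrier x [v, u, u] = - 2 * (\<Sum>r\<in>R. m r * r\<^sup>2)"
    using D(2) Dk_neg_ln_3_commute [OF real_polynomial_function_mp_eval open_pos_cone eval_pos x] by simp
  ultimately show ?thesis using R(1,3) bounds by blast
qed

lemma convex_pos_cone: "convex pos_cone"
  using convex_interior [of "closure pos_cone"] convex_cone_closure
  by (simp add: convex_cone_def interior_closure_pos_cone)

text \<open>On the segment, \<open>ln p\<close> is a constant plus the sum of
  \<open>ln (1 + t * l j)\<close>. Each summand is handled by concavity of \<open>ln\<close> between
  1 and \<open>1 + l j\<close>.\<close>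

lemma convex_on_barrier: "convex_on pos_cone barrier"
proof (rule convex_onI [OF _ convex_pos_cone])
  fix t :: real and x y assume t: "t > 0" "t < 1" and x: "x \<in> pos_cone" and y: "y \<in> pos_cone"
  obtain l :: "nat \<Rightarrow> real" where
    l: "\<And>t. mp_eval p (x + t *\<^sub>R (y - x)) = mp_eval p x * (\<Prod>j<d. 1 + t * l j)"
    using eval_line_factorization [OF x, of "y - x"] by blast
  have seg: "x + s *\<^sub>R (y - x) \<in> pos_cone" if "s \<in> {0..1}" for s
    using convexD_alt [OF convex_pos_cone x y, of s] that by (simp add: algebra_simps)
  have pos: "1 + l j > 0" if "j < d" for j
  proof (rule ccontr)
    assume *: "\<not> 1 + l j > 0"
    \<comment> \<open>The zero of the factor with index \<open>j\<close>. The negated claim means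
      \<open>l j \<le> - 1\<close>, so this zero would lie on the segment, inside the cone.\<close>
    define s where "s = - 1 / l j"
    have s: "s \<in> {0..1}" using * by (auto simp: s_def field_simps)
    have "1 + s * l j = 0" using * by (auto simp: s_def)
    then have "mp_eval p (x + s *\<^sub>R (y - x)) = 0" unfolding l using that by auto
    then show False using eval_pos [OF seg [OF s]] by simp
  qed
  have posT: "1 + t * l j > 0" and conc: "ln (1 + t * l j) \<ge> t * ln (1 + l j)" if "j < d" for j
  proof -
    have eq: "1 + t * l j = (1 - t) * 1 + t * (1 + l j)" by (simp add: algebra_simps)
    have "(1 - t) * 1 + t * (1 + l j) > 0"
      using t pos [OF that] by (intro add_pos_pos) auto
    moreover have "ln ((1 - t) *\<^sub>R 1 + t *\<^sub>R (1 + l j)) \<ge> (1 - t) * ln 1 + t * ln (1 + l j)"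
      using t pos [OF that] by (intro concave_onD [OF ln_concave]) auto
    ultimately show "1 + t * l j > 0" "ln (1 + t * l j) \<ge> t * ln (1 + l j)"
      unfolding eq by simp_all
  qed
  have ln_eq: "ln (\<Prod>j<d. 1 + t * l j) = (\<Sum>j<d. ln (1 + t * l j))"
    "ln (\<Prod>j<d. 1 + l j) = (\<Sum>j<d. ln (1 + l j))"
    by (rule ln_prod; use posT pos in force)+
  have prod_gt: "(\<Prod>j<d. 1 + t * l j) > 0" "(\<Prod>j<d. 1 + l j) > 0"
    by (auto intro!: prod_pos posT pos)
  have "ln (mp_eval p y) = ln (mp_eval p x) + (\<Sum>j<d. ln (1 + l j))"
    using l [of 1] ln_mult_pos [OF eval_pos [OF x] prod_gt(2)] unfolding ln_eq(2) by simp
  moreover have "ln (mp_eval p ((1 - t) *\<^sub>R x + t *\<^sub>R y)) = ln (mp_eval p x) + (\<Sum>j<d. ln (1 + t * l j))"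
  proof -
    have "(1 - t) *\<^sub>R x + t *\<^sub>R y = x + t *\<^sub>R (y - x)" by (simp add: algebra_simps)
    then show ?thesis
      using l [of t] ln_mult_pos [OF eval_pos [OF x] prod_gt(1)] unfolding ln_eq(1) by simp
  qed
  moreover have "t * (\<Sum>j<d. ln (1 + l j)) \<le> (\<Sum>j<d. ln (1 + t * l j))"
    unfolding sum_distrib_left using conc by (intro sum_mono) auto
  ultimately show "barrier ((1 - t) *\<^sub>R x + t *\<^sub>R y) \<le> (1 - t) * barrier x + t * barrier y"
    by (simp add: algebra_simps)
qed

text \<open>The open cone is the part of its closure where \<open>p > 0\<close>. Rewriting
  \<open>- ln p \<le> y\<close> as \<open>exp (- y) \<le> p\<close> forces this positivity, so the
  epigraph is an intersection of two closed sets.\<close>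

lemma closed_epigraph_barrier: "closed (epigraph pos_cone barrier)"
proof -
  have iff: "x \<in> pos_cone \<longleftrightarrow> x \<in> closure pos_cone \<and> mp_eval p x > 0" for x
  proof (intro iffI conjI)
    assume x: "x \<in> closure pos_cone \<and> mp_eval p x > 0"
    have "mp_eval p (x + s *\<^sub>R e) \<noteq> 0" if "s \<ge> 0" for s
    proof (cases "s = 0")
      case False
      then have "x + s *\<^sub>R e \<in> pos_cone" using x that by (simp add: closure_pos_cone_iff)
      then show ?thesis using eval_pos by fastforce
    qed (use x in simp)
    then show "x \<in> pos_cone" by (simp add: pos_cone_def)
  qed (use closure_subset [of pos_cone] eval_pos in auto)
  have "epigraph pos_cone barrier =
      {z. fst z \<in> closure pos_cone} \<inter> {z. exp (- snd z) \<le> mp_eval p (fst z)}"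
  proof (rule set_eqI, clarify)
    fix x :: "real ^ 'n" and y :: real
    have "- ln a \<le> y \<longleftrightarrow> exp (- y) \<le> a" if "a > 0" for a
      using ln_ge_iff [OF that, of "- y"] by linarith
    moreover have "mp_eval p x > 0" if "exp (- y) \<le> mp_eval p x"
      using that exp_gt_zero [of "- y"] by linarith
    ultimately show "(x, y) \<in> epigraph pos_cone barrier \<longleftrightarrow>
        (x, y) \<in> {z. fst z \<in> closure pos_cone} \<inter> {z. exp (- snd z) \<le> mp_eval p (fst z)}"
      unfolding mem_epigraph iff by auto
  qed
  moreover have "closed \<dots>"
  proof (rule closed_Int)
    have "closed (fst -` closure pos_cone :: ((real ^ 'n) \<times> real) set)"
      by (intro closed_vimage closed_closure continuous_intros)
    then show "closed {z :: (real ^ 'n) \<times> real. fst z \<in> closure pos_cone}" by (simp add: vimage_def)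
    show "closed {z. exp (- snd z) \<le> mp_eval p (fst z)}"
      by (intro closed_Collect_le continuous_intros)
  qed
  ultimately show ?thesis by simp
qed

lemma full_dimensional_closure: "full_dimensional (closure pos_cone)"
proof -
  have "x \<in> span (closure pos_cone)" for x
  proof -
    obtain \<epsilon> where \<epsilon>: "\<epsilon> > 0" "\<forall>t. \<bar>t\<bar> \<le> \<epsilon> \<longrightarrow> e + t *\<^sub>R x \<in> pos_cone"
      using pos_cone_line [OF e_in_pos_cone, of x] by blast
    then have "e + \<epsilon> *\<^sub>R x \<in> pos_cone" by simp
    then have "(e + \<epsilon> *\<^sub>R x) - e \<in> span (closure pos_cone)"
      using closure_subset [of pos_cone] e_in_pos_cone by (intro span_diff span_base) auto
    then have "(1 / \<epsilon>) *\<^sub>R ((e + \<epsilon> *\<^sub>R x) - e) \<in> span (closure pos_cone)" by (rule span_scale)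
    then show ?thesis using \<epsilon>(1) by simp
  qed
  then show ?thesis by (auto simp: full_dimensional_def)
qed

lemma log_homogeneous_barrier: "log_homogeneous_barrier d (closure pos_cone) pos_cone barrier"
  unfolding log_homogeneous_barrier_def standard_self_concordant_def
proof (intro conjI ballI allI impI)
  show "cont_diff_on 3 barrier pos_cone"
    using cont_diff_on_neg_ln [OF real_polynomial_function_mp_eval open_pos_cone eval_pos, of 2] by (simp add: eval_nat_numeral)
  fix x and t :: real assume x: "x \<in> pos_cone" and "t > 0"
  then show "t *\<^sub>R x \<in> pos_cone" by (rule pos_cone_scaleR)
  show "barrier (t *\<^sub>R x) = barrier x - real d * ln t"
    using \<open>t > 0\<close> eval_pos [OF x] by (simp add: mp_eval_scaleR [OF hom] ln_mult ln_realpow)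
qed (simp_all add: convex_cone_closure full_dimensional_closure open_pos_cone convex_on_barrier
    closed_epigraph_barrier barrier_self_concordance)

text \<open>A closed nonempty set bounded below contains its infimum. Pointedness yields the lower
  bound 0: a negative element would put \<open>- x\<close> into the closure, hence 0 into the open
  cone, which would then be the whole space.\<close>

lemma cone_norm_attained:
  assumes pointed: "pointed_cone (closure pos_cone)" and x: "x \<in> pos_cone"
  shows "cone_norm (closure pos_cone) x u *\<^sub>R x - u \<in> closure pos_cone"
proof -
  define S where "S = {t. cone_le (closure pos_cone) (- t *\<^sub>R x) u \<and> cone_le (closure pos_cone) u (t *\<^sub>R x)}"
  have S: "S = (\<lambda>t. u + t *\<^sub>R x) -` closure pos_cone \<inter> (\<lambda>t. t *\<^sub>R x - u) -` closure pos_cone"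
    by (auto simp: S_def cone_le_def)
  have "closed S"
    unfolding S by (intro closed_Int closed_vimage closed_closure continuous_intros)
  moreover have "S \<noteq> {}"
  proof -
    obtain \<epsilon> where \<epsilon>: "\<epsilon> > 0" "\<forall>t. \<bar>t\<bar> \<le> \<epsilon> \<longrightarrow> x + t *\<^sub>R u \<in> pos_cone"
      using pos_cone_line [OF x, of u] by blast
    \<comment> \<open>If \<open>x\<close> tolerates a perturbation by \<open>\<epsilon> u\<close> in
      both directions, rescaling shows that \<open>1 / \<epsilon>\<close> bounds \<open>u\<close> on
      both sides.\<close>
    have "(1 / \<epsilon>) *\<^sub>R (x + \<epsilon> *\<^sub>R u) \<in> pos_cone" "(1 / \<epsilon>) *\<^sub>R (x + (- \<epsilon>) *\<^sub>R u) \<in> pos_cone"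
      using \<epsilon> by (auto intro!: pos_cone_scaleR simp del: scaleR_minus_left)
    then have "u + (1 / \<epsilon>) *\<^sub>R x \<in> pos_cone" "(1 / \<epsilon>) *\<^sub>R x - u \<in> pos_cone"
      using \<epsilon>(1) by (simp_all add: algebra_simps)
    then have "1 / \<epsilon> \<in> S" using closure_subset [of pos_cone] by (auto simp: S)
    then show ?thesis by blast
  qed
  moreover have "t \<ge> 0" if "t \<in> S" for t
  proof (rule ccontr)
    assume "\<not> t \<ge> 0"
    have "u + t *\<^sub>R x \<in> closure pos_cone" "t *\<^sub>R x - u \<in> closure pos_cone"
      using that by (auto simp: S)
    then have "(u + t *\<^sub>R x) + (t *\<^sub>R x - u) \<in> closure pos_cone"
      by (rule closure_pos_cone_add)
    then have "(1 / (- 2 * t)) *\<^sub>R ((u + t *\<^sub>R x) + (t *\<^sub>R x - u)) \<in> closure pos_cone"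
      using \<open>\<not> t \<ge> 0\<close> by (intro closure_pos_cone_scaleR) auto
    moreover have "(1 / (- 2 * t)) *\<^sub>R ((u + t *\<^sub>R x) + (t *\<^sub>R x - u)) = - x"
      using \<open>\<not> t \<ge> 0\<close> by (simp flip: scaleR_2 scaleR_add_left)
    ultimately have "- x \<in> closure pos_cone" by simp
    then have 0: "0 \<in> pos_cone" using closure_add_pos_cone [OF _ x] by fastforce
    have "w \<in> closure pos_cone" for w
    proof -
      obtain \<epsilon> where \<epsilon>: "\<epsilon> > 0" "\<forall>t. \<bar>t\<bar> \<le> \<epsilon> \<longrightarrow> 0 + t *\<^sub>R w \<in> pos_cone"
        using pos_cone_line [OF 0, of w] by blast
      then have "\<epsilon> *\<^sub>R w \<in> pos_cone" by simp
      from pos_cone_scaleR [OF this, of "1 / \<epsilon>"] have "w \<in> pos_cone" using \<epsilon>(1) by simp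
      then show ?thesis using closure_subset by blast
    qed
    then have "closure pos_cone \<inter> uminus ` closure pos_cone = UNIV"
      by (auto intro: image_eqI [of _ _ "- z" for z])
    then have "(UNIV :: (real ^ 'n) set) = {0}" using pointed by (simp add: pointed_cone_def)
    \<comment> \<open>The index type is nonempty, so a coordinate vector supplies a nonzero
      element.\<close>
    then have "axis undefined 1 \<in> {0 :: real ^ 'n}" by blast
    then show False by (simp add: axis_eq_0_iff)
  qed
  then have "bdd_below S" by (auto simp: bdd_below_def)
  ultimately have "Inf S \<in> S" by (intro closed_contains_Inf)
  then show ?thesis unfolding cone_norm_def S_def by (simp add: cone_le_def)
qed

text \<open>Both inequalities are read off from the moments: the weights are nonnegative and the
  nodes lie between 0 and the cone norm, so \<open>m r * r\<^sup>2\<close> is at most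
  \<open>m r * r * c\<close>.\<close>

lemma barrier_pairwise:
  assumes pointed: "pointed_cone (closure pos_cone)" and x: "x \<in> pos_cone"
    and u: "u \<in> closure pos_cone" and v: "v \<in> closure pos_cone"
  shows "0 \<le> - Dk barrier x [v, u, u]"
    and "- Dk barrier x [v, u, u] \<le> 2 * Dk barrier x [v, u] * cone_norm (closure pos_cone) x u"
proof -
  define c where "c = cone_norm (closure pos_cone) x u"
  have "c *\<^sub>R x - u \<in> closure pos_cone"
    unfolding c_def by (rule cone_norm_attained [OF pointed x])
  from barrier_pairwise_moments [OF x u v this]
  obtain R m where R: "\<And>r. r \<in> R \<Longrightarrow> 0 \<le> r \<and> r \<le> c" "\<And>r. r \<in> R \<Longrightarrow> m r \<ge> 0"
    "Dk barrier x [v, u] = (\<Sum>r\<in>R. m r * r)"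
    "Dk barrier x [v, u, u] = - 2 * (\<Sum>r\<in>R. m r * r\<^sup>2)"
    by blast
  show "0 \<le> - Dk barrier x [v, u, u]"
    unfolding R(4) using R(2) by (simp add: sum_nonneg)
  have "(\<Sum>r\<in>R. m r * r\<^sup>2) \<le> (\<Sum>r\<in>R. m r * r * c)"
  proof (rule sum_mono)
    fix r assume "r \<in> R"
    then have "m r * r * r \<le> m r * r * c" using R(1,2) by (intro mult_left_mono) auto
    then show "m r * r\<^sup>2 \<le> m r * r * c" by (simp add: power2_eq_square mult.assoc)
  qed
  then show "- Dk barrier x [v, u, u] \<le> 2 * Dk barrier x [v, u] * cone_norm (closure pos_cone) x u"
    unfolding R(3,4) c_def [symmetric] by (simp add: sum_distrib_right)
qed

end

theorem corollary6p4:
  fixes p :: "('n::finite) rmpoly" and d :: nat and e :: "real ^ 'n"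
  assumes "homogeneous d p"
    and "hyperbolic p e"
    and "pointed_cone (hyp_cone d p e)"
  shows "pairwise_self_concordant (hyp_cone d p e) (interior (hyp_cone d p e))
           (\<lambda>x. - ln (mp_eval p x))"
proof -
  interpret hyperbolic_poly p d e
    using assms(1,2) by unfold_locales
  show ?thesis
    using assms(3) log_homogeneous_barrier barrier_pairwise
    unfolding pairwise_self_concordant_def hyp_cone_eq interior_closure_pos_cone
    by (intro conjI ballI exI)
qed

end
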